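(* Let $f:\mathbb{R}^n\to\mathbb{R}$ be continuously differentiable with $\|\nabla f(x)-\nabla f(y)\|\le L\|x-y\|$ for all $x,y\in\mathbb{R}^n$, where $L>0$. Let $\{x^k\}$ be generated by the extragradient method with momentum (EGm, see context) on $X=\mathbb{R}^n$ with $\bar\beta=\sup_k\beta_k<1$, $\bar\delta=\sup_k|\beta_k-\gamma_k|<\infty$, $\tau_1,\tau_2>0$, such that for some $\nu\in(0,1)$ $$\tau_2\le\frac{\nu}{L(\nu+1)},\qquad \max\{L\tau_1,\ 2L\tau_1\bar\delta+(L\tau_1+1)\bar\beta^2\}<1-\nu,$$ and suppose $\nabla f(x^k_{\rm ex})\ne0$ for all $k\in\mathbb{N}$. If $\inf_{k\in\mathbb{N}}f(x^k)>-\infty$, then the following hold. (i) $\nabla f(x^k)\to 0$ as $k\to\infty$. (ii) If $f$ satisfies the basic PLK condition at an accumulation point $\bar x$ of $\{x^k\}$, then $\{x^k\}$ converges to $\bar x$, and $\bar x$ is a stationary point of $f$. (iii) Assume that $f$ satisfies the PLK condition at an accumulation point $\bar x$ of $\{x^k\}$ with the desingularizing function $\psi(t)=Mt^{1-q}$, where $M>0$ and $q\in[0,1)$. Then: - if $q\in[0,1/2]$, the sequences $\{x^k\}$, $\{\nabla f(x^k)\}$, $\{f(x^k)\}$ converge linearly to $\bar x$, $0$, $f(\bar x)$, respectively; - if $q\in(1/2,1)$, then as $k\to\infty$ $$\|x^k-\bar x\|=\mathcal{O}\big(k^{-\frac{1-q}{2q-1}}\big),\quad \|\nabla f(x^k)\|=\mathcal{O}\big(k^{-\frac{1-q}{2q-1}}\big),\quad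 f(x^k)-f(\bar x)=\mathcal{O}\big(k^{-\frac{2-2q}{2q-1}}\big).$$
   Context: $\|\cdot\|$ is the Euclidean norm and $\mathbb{N}=\{1,2,\dots\}$. EGm: choose $x^0=x^1\in X$, $\{\beta_k\},\{\gamma_k\}\subset[0,\infty)$, $\tau_1,\tau_2>0$ with $\bar\beta:=\sup_k\beta_k<1$ and $\bar\delta:=\sup_k|\beta_k-\gamma_k|<\infty$. For each $k\ge1$ put $x^k_{\rm in}:=x^k+\beta_k(x^k-x^{k-1})$, $x^k_{\rm ex}:=x^k+\gamma_k(x^k-x^{k-1})$, $x^{k+1}:=x^k_{\rm in}-\tau_1\nabla f\big(x^k_{\rm ex}-\tau_2\nabla f(x^k_{\rm ex})\big)$. PLK (Polyak-Łojasiewicz-Kurdyka) condition for a $C^1$ function $f$ at $\bar x$ with desingularizing function $\varphi$: there are $\eta\in(0,\infty]$, a neighborhood $U$ of $\bar x$ and a concave function $\varphi:[0,\eta)\to[0,\infty)$ such that $\varphi(0)=0$, $\varphi$ is $C^1$ on $(0,\eta)$, $\varphi'>0$ on $(0,\eta)$, and $\varphi'(f(x)-f(\bar x))\|\nabla f(x)\|\ge1$ for all $x\in U$ with $f(\bar x)<f(x)<f(\bar x)+\eta$. The basic PLK condition means that this holds with some $\varphi$ of this kind. A stationary point of $f$ is a point where $\nabla f$ vanishes. A sequence $\{u^k\}$ converges linearly to $u$ if $\|u^k-u\|=\mathcal{O}(\mu^k)$ for some $\mu\in(0,1)$ (R-linear convergence). *)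

theory Defs
  imports "HOL-Analysis.Analysis" "HOL-Library.Landau_Symbols"
begin

definition grad :: "('a::euclidean_space \<Rightarrow> real) \<Rightarrow> 'a \<Rightarrow> 'a" where
  "grad f x = (THE D. GDERIV f x :> D)"

lemma grad_eqI:
  assumes "GDERIV f x :> D"
  shows "grad f x = D"
  unfolding grad_def
proof (rule the_equality)
  show "GDERIV f x :> D" by fact
next
  fix E assume "GDERIV f x :> E"
  with assms have "(\<lambda>h. inner h E) = (\<lambda>h. inner h D)"
    unfolding gderiv_def by (rule has_derivative_unique[rotated])
  then show "E = D"
    by (metis vector_eq_ldot)
qed

lemma differentiable_imp_gderiv_grad:
  assumes "f differentiable (at x)"
  shows "GDERIV f x :> grad f x"
proof -
  obtain f' where f': "(f has_derivative f') (at x)"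
    using assms by (auto simp: differentiable_def)
  then interpret linear f'
    by (rule has_derivative_linear)
  have "f' = (\<lambda>h. inner h (adjoint f' 1))"
    using adjoint_works[OF linear_axioms] by (simp add: fun_eq_iff)
  with f' have "GDERIV f x :> adjoint f' 1"
    by (simp add: gderiv_def)
  then show ?thesis
    using grad_eqI by metis
qed

definition C1_function :: "('a::euclidean_space \<Rightarrow> real) \<Rightarrow> bool" where
  "C1_function f \<longleftrightarrow> (\<forall>x. f differentiable (at x)) \<and> continuous_on UNIV (grad f)"

definition stationary_point :: "('a::euclidean_space \<Rightarrow> real) \<Rightarrow> 'a \<Rightarrow> bool" where
  "stationary_point f a \<longleftrightarrow> grad f a = 0"

definition accumulation_point :: "(nat \<Rightarrow> 'a::topological_space) \<Rightarrow> 'a \<Rightarrow> bool" where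
  "accumulation_point u a \<longleftrightarrow> (\<exists>r. strict_mono r \<and> (u \<circ> r) \<longlonglongrightarrow> a)"

definition converges_linearly :: "(nat \<Rightarrow> 'a::real_normed_vector) \<Rightarrow> 'a \<Rightarrow> bool" where
  "converges_linearly u a \<longleftrightarrow> (\<exists>\<mu>. 0 < \<mu> \<and> \<mu> < 1 \<and> (\<lambda>k. norm (u k - a)) \<in> O(\<lambda>k. \<mu> ^ k))"

text \<open>The desingularizing function is a total function on the reals of which only the values
  on \<open>[0, \<eta>)\<close> matter; \<open>\<eta>\<close> may be \<open>\<infinity>\<close>. Continuity of \<open>\<phi>\<close> at \<open>0\<close> is not required.\<close>

definition desingularizing :: "ereal \<Rightarrow> (real \<Rightarrow> real) \<Rightarrow> bool" where
  "desingularizing \<eta> \<phi> \<longleftrightarrow>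
     concave_on {t. 0 \<le> t \<and> ereal t < \<eta>} \<phi> \<and>
     (\<forall>t. 0 \<le> t \<and> ereal t < \<eta> \<longrightarrow> 0 \<le> \<phi> t) \<and>
     \<phi> 0 = 0 \<and>
     (\<forall>t. 0 < t \<and> ereal t < \<eta> \<longrightarrow> \<phi> differentiable (at t)) \<and>
     continuous_on {t. 0 < t \<and> ereal t < \<eta>} (deriv \<phi>) \<and>
     (\<forall>t. 0 < t \<and> ereal t < \<eta> \<longrightarrow> 0 < deriv \<phi> t)"

definition PLK_with :: "('a::euclidean_space \<Rightarrow> real) \<Rightarrow> 'a \<Rightarrow> (real \<Rightarrow> real) \<Rightarrow> bool" where
  "PLK_with f a \<phi> \<longleftrightarrow>
     (\<exists>\<eta> U. 0 < \<eta> \<and> open U \<and> a \<in> U \<and> desingularizing \<eta> \<phi> \<and>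
        (\<forall>x\<in>U. f a < f x \<and> ereal (f x) < ereal (f a) + \<eta> \<longrightarrow>
           1 \<le> deriv \<phi> (f x - f a) * norm (grad f x)))"

definition basic_PLK :: "('a::euclidean_space \<Rightarrow> real) \<Rightarrow> 'a \<Rightarrow> bool" where
  "basic_PLK f a \<longleftrightarrow> (\<exists>\<phi>. PLK_with f a \<phi>)"

text \<open>Extragradient method with momentum on the whole space. The parameters \<open>\<beta>\<close>, \<open>\<gamma>\<close> are
  indexed by \<open>k \<ge> 1\<close>; their values at \<open>0\<close> are irrelevant.\<close>

definition extrapolate :: "(nat \<Rightarrow> real) \<Rightarrow> (nat \<Rightarrow> 'a::real_vector) \<Rightarrow> nat \<Rightarrow> 'a" where
  "extrapolate c x k = x k + c k *\<^sub>R (x k - x (k - 1))"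

definition beta_bar :: "(nat \<Rightarrow> real) \<Rightarrow> real" where
  "beta_bar \<beta> = (SUP k\<in>{1..}. \<beta> k)"

definition delta_bar :: "(nat \<Rightarrow> real) \<Rightarrow> (nat \<Rightarrow> real) \<Rightarrow> real" where
  "delta_bar \<beta> \<gamma> = (SUP k\<in>{1..}. \<bar>\<beta> k - \<gamma> k\<bar>)"

text \<open>The \<open>bdd_above\<close> conjuncts say that the two suprema are finite.\<close>

definition EGm ::
  "('a::euclidean_space \<Rightarrow> real) \<Rightarrow> (nat \<Rightarrow> real) \<Rightarrow> (nat \<Rightarrow> real) \<Rightarrow> real \<Rightarrow> real \<Rightarrow> (nat \<Rightarrow> 'a) \<Rightarrow> bool" where
  "EGm f \<beta> \<gamma> \<tau>1 \<tau>2 x \<longleftrightarrow>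
     (\<forall>k\<ge>1. 0 \<le> \<beta> k \<and> 0 \<le> \<gamma> k) \<and> 0 < \<tau>1 \<and> 0 < \<tau>2 \<and>
     bdd_above (\<beta> ` {1..}) \<and> beta_bar \<beta> < 1 \<and>
     bdd_above ((\<lambda>k. \<bar>\<beta> k - \<gamma> k\<bar>) ` {1..}) \<and>
     x 0 = x 1 \<and>
     (\<forall>k\<ge>1. x (Suc k) =
        extrapolate \<beta> x k
        - \<tau>1 *\<^sub>R grad f (extrapolate \<gamma> x k - \<tau>2 *\<^sub>R grad f (extrapolate \<gamma> x k)))"

end

theory Submission
  imports Defs
begin

text \<open>The half step is an inexact gradient with relative error \<open>\<nu>\<close>, and the step size condition makes the
  energy \<open>f (x k) + A \<parallel>x k - x (k - 1)\<parallel>\<^sup>2\<close> decrease by a multiple of the squared length of the next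
  step; hence the steps and the gradients tend to \<open>0\<close>. The gradient is bounded by two consecutive
  steps, so the PLK inequality for \<open>f\<close> becomes one for the energy gap \<open>h\<close>, with desingularizing
  function \<open>2 C \<phi> (t / 2) + 2 sqrt (2 A t)\<close>. Composing it with the gap gives a potential that bounds
  the sum of all later steps, which traps the iterates near the accumulation point. If
  \<open>\<phi> t = M t\<^bsup>1 - q\<^esup>\<close>, then with \<open>p = max q (1 / 2)\<close> the sums \<open>S k = h k + h (k + 1)\<close> satisfy
  \<open>S (k + 1)\<^bsup>2 p\<^esup> \<le> D (S k - S (k + 1))\<close> and the iterates are within \<open>O (S\<^bsup>1 - p\<^esup>)\<close> of their limit;
  the rates for gradients and values follow since the gradient is Lipschitz and vanishes there.\<close>

section \<open>Smooth and desingularizing functions\<close>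

text \<open>On the segment from \<open>z\<close> to \<open>y\<close>, Cauchy-Schwarz and the
  Lipschitz bound make the auxiliary function \<open>\<phi>\<close> nonincreasing; the claim
  compares its values at 1 and 0.\<close>

lemma lipschitz_gradient_upper:
  fixes f :: "'a::real_inner \<Rightarrow> real"
  assumes deriv: "\<And>z. GDERIV f z :> g z"
    and lip: "\<And>y z. norm (g y - g z) \<le> L * norm (y - z)"
  shows "f y \<le> f z + g z \<bullet> (y - z) + L / 2 * (norm (y - z))\<^sup>2"
proof -
  define w where "w = y - z"
  define \<phi> where "\<phi> t = f (z + t *\<^sub>R w) - t * (g z \<bullet> w) - L / 2 * t\<^sup>2 * (norm w)\<^sup>2" for t :: real
  have D: "(\<phi> has_real_derivative (g (z + t *\<^sub>R w) - g z) \<bullet> w - L * t * (norm w)\<^sup>2) (at t)" for t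
  proof -
    have "((\<lambda>t. f (z + t *\<^sub>R w)) has_derivative (\<lambda>h. (h *\<^sub>R w) \<bullet> g (z + t *\<^sub>R w))) (at t)"
      by (rule has_derivative_compose[where f = "\<lambda>t. z + t *\<^sub>R w", OF _ deriv[unfolded gderiv_def]])
        (auto intro!: derivative_eq_intros)
    then have "((\<lambda>t. f (z + t *\<^sub>R w)) has_real_derivative g (z + t *\<^sub>R w) \<bullet> w) (at t)"
      by (simp add: has_field_derivative_def inner_commute mult_commute_abs)
    then show ?thesis
      unfolding \<phi>_def
      by (auto intro!: derivative_eq_intros simp: inner_diff_left)
  qed
  have "\<phi> 1 \<le> \<phi> 0"
  proof (rule DERIV_nonpos_imp_nonincreasing[of 0 1 \<phi>])
    fix t :: real
    assume t: "0 \<le> t" "t \<le> 1"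
    have "(g (z + t *\<^sub>R w) - g z) \<bullet> w \<le> norm (g (z + t *\<^sub>R w) - g z) * norm w"
      by (rule norm_cauchy_schwarz)
    also have "\<dots> \<le> L * norm (t *\<^sub>R w) * norm w"
      using lip[of "z + t *\<^sub>R w" z] by (intro mult_right_mono) auto
    also have "\<dots> = L * t * (norm w)\<^sup>2"
      using t by (simp add: power2_eq_square)
    finally show "\<exists>y. (\<phi> has_real_derivative y) (at t) \<and> y \<le> 0"
      using D by (intro exI conjI) auto
  qed simp
  then show ?thesis
    by (simp add: \<phi>_def w_def)
qed

lemma lipschitz_gradient_lower:
  fixes f :: "'a::real_inner \<Rightarrow> real"
  assumes "\<And>z. GDERIV f z :> g z"
    and lip: "\<And>y z. norm (g y - g z) \<le> L * norm (y - z)"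
  shows "f z + g z \<bullet> (y - z) - L / 2 * (norm (y - z))\<^sup>2 \<le> f y"
proof -
  have "norm (- g y - - g z) \<le> L * norm (y - z)" for y z
    using lip[of z y] by (simp add: norm_minus_commute)
  then show ?thesis
    using lipschitz_gradient_upper[of "\<lambda>z. - f z" "\<lambda>z. - g z" L y z] GDERIV_minus[OF assms(1)]
    by auto
qed

section \<open>Tangent inequalities for concave desingularizing functions\<close>

lemma concave_on_tangent:
  fixes \<phi> :: "real \<Rightarrow> real"
  assumes "concave_on S \<phi>" "connected S" "c \<in> interior S" "s \<in> S"
    and "(\<phi> has_real_derivative D) (at c)"
  shows "D * (c - s) \<le> \<phi> c - \<phi> s"
proof -
  have "((\<lambda>t. - \<phi> t) has_real_derivative - D) (at c within S)"
    by (rule DERIV_minus[OF has_field_derivative_at_within[OF assms(5)]])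
  then have "- \<phi> s - - \<phi> c \<ge> - D * (s - c)"
    using assms by (intro convex_on_imp_above_tangent[of S]) (auto simp: concave_on_def)
  then show ?thesis
    by (simp add: algebra_simps)
qed

lemma desingularizing_tangent:
  assumes "desingularizing \<eta> \<phi>" "ereal r \<le> \<eta>" "0 \<le> s" "0 < t" "s < r" "t < r"
  shows "deriv \<phi> t * (t - s) \<le> \<phi> t - \<phi> s"
proof (rule concave_on_tangent[of "{0..<r}"])
  have *: "ereal u < \<eta>" if "u < r" for u
    using that assms(2) by (meson less_ereal.simps(1) order_less_le_trans)
  show "concave_on {0..<r} \<phi>"
    using assms(1) *
    by (auto simp: desingularizing_def concave_on_def elim!: convex_on_subset)
  show "(\<phi> has_real_derivative deriv \<phi> t) (at t)"
    using assms * by (simp add: desingularizing_def DERIV_deriv_iff_real_differentiable)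
qed (use assms in auto)

text \<open>Adding the tangent inequalities at \<open>s\<close> and at \<open>t\<close> cancels the
  values of \<open>\<phi>\<close>.\<close>

lemma desingularizing_deriv_antimono:
  assumes "desingularizing \<eta> \<phi>" "ereal r \<le> \<eta>" "0 < s" "s \<le> t" "t < r"
  shows "deriv \<phi> t \<le> deriv \<phi> s"
proof (cases "s = t")
  case False
  have "deriv \<phi> t * (t - s) \<le> deriv \<phi> s * (t - s)"
    using desingularizing_tangent[of \<eta> \<phi> r s t] desingularizing_tangent[of \<eta> \<phi> r t s] assms
    by (simp add: algebra_simps)
  then show ?thesis
    using False assms by simp
qed simp

text \<open>A real \<open>r\<close> below \<open>\<eta>\<close> replaces the extended real bound, so
  that an infinite \<open>\<eta>\<close> needs no separate treatment later.\<close>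

lemma PLK_withE:
  assumes "PLK_with f a \<phi>"
  obtains r \<eta> U where "0 < r" "ereal r \<le> \<eta>" "desingularizing \<eta> \<phi>" "open U" "a \<in> U"
    "\<And>x. x \<in> U \<Longrightarrow> f a < f x \<Longrightarrow> f x - f a < r \<Longrightarrow> 1 \<le> deriv \<phi> (f x - f a) * norm (grad f x)"
proof -
  from assms obtain \<eta> U where U: "0 < \<eta>" "open U" "a \<in> U" "desingularizing \<eta> \<phi>"
    and PLK: "\<And>x. x \<in> U \<Longrightarrow> f a < f x \<Longrightarrow> ereal (f x) < ereal (f a) + \<eta> \<Longrightarrow>
       1 \<le> deriv \<phi> (f x - f a) * norm (grad f x)"
    unfolding PLK_with_def by auto
  obtain r where r: "0 < r" "ereal r < \<eta>"
    using ereal_dense2[OF U(1)] by auto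
  have "ereal (f x) < ereal (f a) + \<eta>" if "f x - f a < r" for x
    using that r by (cases \<eta>) auto
  then show thesis
    using that[of r \<eta> U] U r PLK by auto
qed

section \<open>Descent potentials and recursive inequalities\<close>

text \<open>A weighted mean inequality. With \<open>u\<close> the sum of two consecutive step
  lengths, the weight 1/4 leaves twice the new step bounded by a telescoping difference.\<close>

lemma le_of_square_le_mult:
  fixes b u v :: real
  assumes "b\<^sup>2 \<le> u * v" "0 \<le> u" "0 \<le> v"
  shows "b \<le> u / 4 + v"
proof (rule power2_le_imp_le)
  have "(u / 4 + v)\<^sup>2 - u * v = (u / 4 - v)\<^sup>2"
    by (simp add: power2_eq_square algebra_simps)
  then show "b\<^sup>2 \<le> (u / 4 + v)\<^sup>2"
    using assms(1) by (smt (verit) zero_le_power2)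
qed (use assms in auto)

text \<open>The step bound is asked only between \<open>m\<close> and \<open>n\<close>, so that an
  induction can apply it to the iterates already known to lie in a neighborhood.\<close>

lemma norm_diff_le_potential:
  fixes x :: "nat \<Rightarrow> 'a::real_normed_vector"
  assumes "m \<le> n" "\<And>k. m \<le> k \<Longrightarrow> k < n \<Longrightarrow> 2 * norm (x (Suc k) - x k) \<le> V k - V (Suc k)"
  shows "2 * norm (x n - x m) \<le> V m - V n"
  using assms
proof (induction n rule: dec_induct)
  case (step n)
  have "norm (x (Suc n) - x m) \<le> norm (x (Suc n) - x n) + norm (x n - x m)"
    using norm_triangle_ineq[of "x (Suc n) - x n" "x n - x m"] by simp
  moreover have "2 * norm (x n - x m) \<le> V m - V n"
    by (rule step.IH) (use step.prems in simp)
  moreover have "2 * norm (x (Suc n) - x n) \<le> V n - V (Suc n)"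
    using step.hyps by (intro step.prems) auto
  ultimately show ?case
    by linarith
qed simp

text \<open>Start at an index \<open>m\<close> where \<open>x m\<close> is within
  \<open>e / 2\<close> of \<open>a\<close> and \<open>V\<close> varies by less than
  \<open>e / 2\<close> afterwards. By strong induction the iterates never leave the ball, so the
  step bound holds throughout; then \<open>x\<close> is Cauchy because \<open>V\<close> is, and the
  subsequence identifies the limit.\<close>

lemma potential_trapping:
  fixes x :: "nat \<Rightarrow> 'a::banach"
  assumes "open U" "a \<in> U" "convergent V" "accumulation_point x a"
    and decr: "\<And>k. N \<le> k \<Longrightarrow> x k \<in> U \<Longrightarrow> 2 * norm (x (Suc k) - x k) \<le> V k - V (Suc k)"
  shows "x \<longlonglongrightarrow> a"
proof -
  obtain e where e: "0 < e" "ball a e \<subseteq> U"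
    using assms(1,2) openE by blast
  have V: "Cauchy V"
    by (rule convergent_Cauchy) fact
  then obtain N1 where N1: "\<And>i j. i \<ge> N1 \<Longrightarrow> j \<ge> N1 \<Longrightarrow> norm (V i - V j) < e / 2"
    unfolding Cauchy_iff using e by (metis half_gt_zero)
  obtain r where r: "strict_mono r" "(x \<circ> r) \<longlonglongrightarrow> a"
    using assms(4) by (auto simp: accumulation_point_def)
  have "eventually (\<lambda>i. dist ((x \<circ> r) i) a < e / 2) sequentially"
    using r(2) by (rule tendstoD) (use e in simp)
  moreover have "eventually (\<lambda>i. max N N1 \<le> i) sequentially"
    by (rule eventually_ge_at_top)
  ultimately have "eventually (\<lambda>i. dist (x (r i)) a < e / 2 \<and> max N N1 \<le> r i) sequentially"
    by eventually_elim (use order_trans[OF _ strict_mono_imp_increasing[OF r(1)]] in simp)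
  then obtain i where i: "dist (x (r i)) a < e / 2" "max N N1 \<le> r i"
    using eventually_happens'[OF sequentially_bot] by blast
  define m where "m = r i"
  have m: "dist (x m) a < e / 2" "N \<le> m" "N1 \<le> m"
    using i by (auto simp: m_def)
  have in_U: "x k \<in> U" if "m \<le> k" for k
    using that
  proof (induction k rule: less_induct)
    case (less k)
    have "2 * norm (x k - x m) \<le> V m - V k"
      by (rule norm_diff_le_potential) (use less decr m in auto)
    also have "\<dots> < e / 2"
      using N1[of m k] less.prems m by (auto simp: abs_if split: if_splits)
    finally have "dist (x k) (x m) < e / 2"
      using norm_ge_zero[of "x k - x m"] unfolding dist_norm by linarith
    then have "dist (x k) a < e"
      using m(1) dist_triangle[of "x k" a "x m"] by simp
    then show ?case
      using e(2) by (auto simp: dist_commute)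
  qed
  have dist_le: "norm (x k - x j) \<le> norm (V k - V j)" if "m \<le> j" "j \<le> k" for j k
  proof -
    have "2 * norm (x k - x j) \<le> V j - V k"
      by (rule norm_diff_le_potential) (use that m in_U decr in auto)
    then show ?thesis
      using norm_ge_zero[of "x k - x j"] unfolding real_norm_def by linarith
  qed
  have "Cauchy x"
    unfolding Cauchy_iff
  proof (intro allI impI)
    fix d :: real
    assume "0 < d"
    then obtain M where M: "\<And>i j. i \<ge> M \<Longrightarrow> j \<ge> M \<Longrightarrow> norm (V i - V j) < d"
      using V unfolding Cauchy_iff by blast
    have "norm (x i - x j) < d" if "i \<ge> max m M" "j \<ge> max m M" for i j
    proof (cases "j \<le> i")
      case True
      then show ?thesis
        using dist_le[of j i] M[of i j] that by simp
    next
      case False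
      then show ?thesis
        using dist_le[of i j] M[of j i] that by (simp add: norm_minus_commute)
    qed
    then show "\<exists>M. \<forall>i\<ge>M. \<forall>j\<ge>M. norm (x i - x j) < d"
      by blast
  qed
  then obtain b where b: "x \<longlonglongrightarrow> b"
    using Cauchy_convergent convergent_def by blast
  then have "(x \<circ> r) \<longlonglongrightarrow> b"
    using r(1) by (rule LIMSEQ_subseq_LIMSEQ)
  then show ?thesis
    using b r(2) LIMSEQ_unique by blast
qed

text \<open>Let \<open>n\<close> tend to infinity in the telescoped inequality, after dropping the
  nonnegative last term \<open>V n\<close>.\<close>

lemma potential_limit_bound:
  fixes x :: "nat \<Rightarrow> 'a::real_normed_vector"
  assumes "x \<longlonglongrightarrow> a" "\<And>k. 0 \<le> V k"
    and "eventually (\<lambda>k. 2 * norm (x (Suc k) - x k) \<le> V k - V (Suc k)) sequentially"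
  shows "eventually (\<lambda>k. 2 * norm (x k - a) \<le> V k) sequentially"
proof -
  obtain N where N: "\<And>k. N \<le> k \<Longrightarrow> 2 * norm (x (Suc k) - x k) \<le> V k - V (Suc k)"
    using assms(3) by (auto simp: eventually_sequentially)
  have "2 * norm (x k - a) \<le> V k" if "N \<le> k" for k
  proof -
    have "(\<lambda>n. 2 * norm (x n - x k)) \<longlonglongrightarrow> 2 * norm (a - x k)"
      by (intro tendsto_intros assms(1))
    moreover have "2 * norm (x n - x k) \<le> V k" if "k \<le> n" for n
      using norm_diff_le_potential[of k n x V] N that \<open>N \<le> k\<close> assms(2)[of n] by fastforce
    ultimately have "2 * norm (a - x k) \<le> V k"
      by (intro LIMSEQ_le_const2[where X = "\<lambda>n. 2 * norm (x n - x k)"]) blast+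
    then show ?thesis
      by (simp add: norm_minus_commute)
  qed
  then show ?thesis
    by (auto simp: eventually_sequentially)
qed

section \<open>Rates from recursive inequalities\<close>

lemma linear_recursion_bigo:
  fixes S :: "nat \<Rightarrow> real"
  assumes "0 < \<rho>" "eventually (\<lambda>k. 0 < S k) sequentially"
    and "eventually (\<lambda>k. S (Suc k) \<le> \<rho> * S k) sequentially"
  shows "S \<in> O(\<lambda>k. \<rho> ^ k)"
proof -
  have "eventually (\<lambda>k. 0 < S k \<and> S (Suc k) \<le> \<rho> * S k) sequentially"
    by (intro eventually_conj assms)
  then obtain N where pos: "\<And>k. N \<le> k \<Longrightarrow> 0 < S k"
    and N: "\<And>k. N \<le> k \<Longrightarrow> S (Suc k) \<le> \<rho> * S k"
    by (auto simp: eventually_sequentially)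
  have "S k \<le> S N / \<rho> ^ N * \<rho> ^ k" if "N \<le> k" for k
    using that
  proof (induction k rule: dec_induct)
    case (step k)
    then show ?case
      using N[of k] mult_left_mono[OF step.IH, of \<rho>] assms(1) by (simp add: mult.left_commute)
  qed (use assms in simp)
  then have "eventually (\<lambda>k. norm (S k) \<le> S N / \<rho> ^ N * norm (\<rho> ^ k)) sequentially"
    using assms less_imp_le[OF pos] by (intro eventually_sequentiallyI[of N]) simp
  then show ?thesis
    by (rule bigoI)
qed

text \<open>If \<open>s \<le> 2 * t\<close>, the mean value theorem applies with the derivative comparable to \<open>t powr - \<theta>\<close>;
  otherwise \<open>s powr (1 - \<theta>)\<close> is smaller than \<open>t powr (1 - \<theta>)\<close> by a fixed factor.\<close>

lemma powr_recursion_increment: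
  fixes s t :: real
  assumes "1 < \<theta>" "0 < C" "0 < t" "t \<le> s" "t \<le> 1" and rec: "t powr \<theta> \<le> C * (s - t)"
  shows "min ((\<theta> - 1) * 2 powr - \<theta> / C) (1 - 2 powr (1 - \<theta>)) \<le> t powr (1 - \<theta>) - s powr (1 - \<theta>)"
proof (cases "s \<le> 2 * t")
  case True
  have "t < s"
    using rec assms by (smt (verit) mult_nonneg_nonpos powr_gt_zero)
  then obtain z where z: "t < z" "z < s"
    and eq: "s powr (1 - \<theta>) - t powr (1 - \<theta>) = (s - t) * ((1 - \<theta>) * z powr (1 - \<theta> - 1))"
    using MVT2[of t s "\<lambda>u. u powr (1 - \<theta>)" "\<lambda>u. (1 - \<theta>) * u powr (1 - \<theta> - 1)",
        OF _ has_real_derivative_powr] assms(3)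
    by (meson less_le_trans)
  have "1 / C = t powr - \<theta> * t powr \<theta> / C"
    using assms by (simp add: powr_minus field_simps)
  also have "\<dots> \<le> t powr - \<theta> * (C * (s - t)) / C"
    using rec assms by (intro divide_right_mono mult_left_mono) auto
  also have "\<dots> = t powr - \<theta> * (s - t)"
    using assms by simp
  finally have "2 powr - \<theta> / C \<le> 2 powr - \<theta> * (t powr - \<theta> * (s - t))"
    using mult_left_mono[of "1 / C" "t powr - \<theta> * (s - t)" "2 powr - \<theta>"] by simp
  also have "\<dots> = (2 * t) powr - \<theta> * (s - t)"
    using assms by (simp add: powr_mult)
  also have "\<dots> \<le> z powr - \<theta> * (s - t)"
    using z True assms by (intro mult_right_mono powr_mono2') auto
  finally have "(\<theta> - 1) * (2 powr - \<theta> / C) \<le> (\<theta> - 1) * (z powr - \<theta> * (s - t))"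
    using assms by (intro mult_left_mono) auto
  also have "\<dots> = t powr (1 - \<theta>) - s powr (1 - \<theta>)"
    using eq by (simp add: algebra_simps)
  finally show ?thesis
    by simp
next
  case False
  have "s powr (1 - \<theta>) \<le> (2 * t) powr (1 - \<theta>)"
    using False assms by (intro powr_mono2') auto
  also have "\<dots> = 2 powr (1 - \<theta>) * t powr (1 - \<theta>)"
    using assms by (simp add: powr_mult)
  finally have "(1 - 2 powr (1 - \<theta>)) * t powr (1 - \<theta>) \<le> t powr (1 - \<theta>) - s powr (1 - \<theta>)"
    by (simp add: algebra_simps)
  \<comment> \<open>Here \<open>t \<le> 1\<close> turns the relative gap into an absolute
    one.\<close>
  moreover have "1 \<le> t powr (1 - \<theta>)"
    using assms powr_mono2'[of "1 - \<theta>" t 1] by simp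
  moreover have "2 powr (1 - \<theta>) \<le> 1"
    using assms powr_mono[of "1 - \<theta>" 0 2] by simp
  ultimately show ?thesis
    using mult_left_mono[of 1 "t powr (1 - \<theta>)" "1 - 2 powr (1 - \<theta>)"] by auto
qed

text \<open>The powers \<open>S k powr (1 - \<theta>)\<close> increase by at least a constant
  \<open>c > 0\<close> per step, hence at least linearly in \<open>k\<close>; raising to the
  negative power \<open>- (1 / (\<theta> - 1))\<close> inverts this into a decay rate.\<close>

lemma powr_recursion_bigo:
  fixes S :: "nat \<Rightarrow> real"
  assumes "1 < \<theta>" "0 < C" and pos: "eventually (\<lambda>k. 0 < S k) sequentially" and "S \<longlonglongrightarrow> 0"
    and rec: "eventually (\<lambda>k. S (Suc k) powr \<theta> \<le> C * (S k - S (Suc k))) sequentially"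
  shows "S \<in> O(\<lambda>k. real k powr - (1 / (\<theta> - 1)))"
proof -
  define c where "c = min ((\<theta> - 1) * 2 powr - \<theta> / C) (1 - 2 powr (1 - \<theta>))"
  have "2 powr (1 - \<theta>) < 2 powr 0"
    using assms by (subst powr_less_cancel_iff) auto
  then have c: "0 < c"
    using assms by (auto simp: c_def)
  have "eventually (\<lambda>k. S (Suc k) < 1) sequentially"
    using order_tendstoD(2)[OF LIMSEQ_Suc[OF \<open>S \<longlonglongrightarrow> 0\<close>], of 1] by simp
  moreover have "eventually (\<lambda>k. 0 < S (Suc k)) sequentially"
    by (rule eventually_sequentially_Suc[THEN iffD2, OF pos])
  ultimately have "eventually (\<lambda>k. 0 < S k \<and> c \<le> S (Suc k) powr (1 - \<theta>) - S k powr (1 - \<theta>)) sequentially"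
    using pos rec
  proof eventually_elim
    case (elim k)
    have "0 \<le> C * (S k - S (Suc k))"
      using elim(4) by (rule order_trans[rotated]) simp
    then have "S (Suc k) \<le> S k"
      using \<open>0 < C\<close> by (simp add: zero_le_mult_iff)
    then show ?case
      unfolding c_def using elim assms(1,2) by (intro conjI powr_recursion_increment) auto
  qed
  then obtain N where S_pos: "\<And>k. N \<le> k \<Longrightarrow> 0 < S k"
    and N: "\<And>k. N \<le> k \<Longrightarrow> c \<le> S (Suc k) powr (1 - \<theta>) - S k powr (1 - \<theta>)"
    by (auto simp: eventually_sequentially)
  have growth: "c * real (k - N) \<le> S k powr (1 - \<theta>)" if "N \<le> k" for k
    using that
  proof (induction k rule: dec_induct)
    case (step k)
    then show ?case
      using N[of k] by (simp add: Suc_diff_le algebra_simps)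
  qed simp
  \<comment> \<open>From \<open>2 * N + 1\<close> on, \<open>k - N\<close> is at least
    \<open>k / 2\<close>, whence the constant \<open>c / 2\<close>.\<close>
  have "S k \<le> (c / 2) powr - (1 / (\<theta> - 1)) * real k powr - (1 / (\<theta> - 1))" if "2 * N + 1 \<le> k" for k
  proof -
    have "c / 2 * real k \<le> c * real (k - N)"
      using that c by (simp add: of_nat_diff)
    also have "\<dots> \<le> S k powr (1 - \<theta>)"
      using that by (intro growth) simp
    finally have "(S k powr (1 - \<theta>)) powr - (1 / (\<theta> - 1)) \<le> (c / 2 * real k) powr - (1 / (\<theta> - 1))"
      using that c assms by (intro powr_mono2') auto
    moreover have "(1 - \<theta>) * - (1 / (\<theta> - 1)) = 1"
      using assms by (simp add: field_simps)
    ultimately show ?thesis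
      using S_pos[of k] c that powr_mult[of "c / 2" "real k" "- (1 / (\<theta> - 1))"]
      by (simp add: powr_powr)
  qed
  then have "eventually (\<lambda>k. norm (S k) \<le> (c / 2) powr - (1 / (\<theta> - 1)) * norm (real k powr - (1 / (\<theta> - 1)))) sequentially"
    using less_imp_le[OF S_pos] by (intro eventually_sequentiallyI[of "2 * N + 1"]) simp
  then show ?thesis
    by (rule bigoI)
qed

text \<open>The gap controls the iterates with an index shift of one, which is undone here.\<close>

lemma bigo_unshift:
  fixes u v :: "nat \<Rightarrow> real"
  assumes "(\<lambda>k. u (Suc k)) \<in> O(v)" "v \<in> O(\<lambda>k. w (Suc k))"
  shows "u \<in> O(w)"
proof -
  obtain c where "eventually (\<lambda>k. norm (u (Suc k)) \<le> c * norm (w (Suc k))) sequentially"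
    using landau_o.big_trans[OF assms] by (rule landau_o.bigE)
  then have "eventually (\<lambda>k. norm (u k) \<le> c * norm (w k)) sequentially"
    using eventually_sequentially_Suc[of "\<lambda>k. norm (u k) \<le> c * norm (w k)"] by simp
  then show ?thesis
    by (rule bigoI)
qed

lemma powr_bigo_Suc:
  assumes "s \<le> 0"
  shows "(\<lambda>k. real k powr s) \<in> O(\<lambda>k. real (Suc k) powr s)"
proof (rule bigoI[of _ "2 powr - s"], rule eventually_sequentiallyI[of 1])
  fix k :: nat
  assume "1 \<le> k"
  then have "(2 * real k) powr s \<le> real (Suc k) powr s"
    using assms by (intro powr_mono2') auto
  then have "2 powr - s * (2 powr s * real k powr s) \<le> 2 powr - s * real (Suc k) powr s"
    by (intro mult_left_mono) (auto simp: powr_mult)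
  then show "norm (real k powr s) \<le> 2 powr - s * norm (real (Suc k) powr s)"
    by (simp add: powr_minus field_simps)
qed

section \<open>The extragradient method\<close>

text \<open>Here \<open>a\<close> and \<open>b\<close> are the lengths of two consecutive steps and \<open>c\<close> is \<open>\<tau>1\<close> times the norm of the
  inexact gradient. The cross terms \<open>b * c\<close> and \<open>a * b\<close> are split evenly into squares; the coefficient of
  \<open>c\<^sup>2\<close> is then nonpositive by the first part of the step size condition, and the second part
  says that the coefficient of \<open>b\<^sup>2\<close> exceeds that of \<open>a\<^sup>2\<close>.\<close>

lemma energy_arith:
  fixes a b c :: real
  assumes "L * t \<le> 1 - n" "0 \<le> n" "0 \<le> L" "0 < t" "0 \<le> d" "0 \<le> \<beta>" "\<beta> \<le> B"
    and ip: "2 * t * ip = (\<beta> * a)\<^sup>2 - b\<^sup>2 - c\<^sup>2"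
    and step: "F' \<le> F + ip + (n * (c / t) + L * d * a) * b + L / 2 * (c\<^sup>2 + (\<beta> * a)\<^sup>2)"
  shows "2 * t * F' \<le> 2 * t * F + ((1 + L * t) * B\<^sup>2 + L * t * d) * a\<^sup>2 - (1 - n - L * t * d) * b\<^sup>2"
proof -
  have "2 * t * F' \<le> 2 * t * (F + ip + (n * (c / t) + L * d * a) * b + L / 2 * (c\<^sup>2 + (\<beta> * a)\<^sup>2))"
    using step \<open>0 < t\<close> by (intro mult_left_mono) auto
  also have "\<dots> = 2 * t * F + 2 * t * ip + n * (2 * c * b) + L * t * d * (2 * a * b) + L * t * (c\<^sup>2 + (\<beta> * a)\<^sup>2)"
    using \<open>0 < t\<close> by (simp add: field_simps)
  also have "\<dots> = 2 * t * F + (1 + L * t) * (\<beta> * a)\<^sup>2 - b\<^sup>2 - (1 - L * t) * c\<^sup>2 + n * (2 * c * b) + L * t * d * (2 * a * b)"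
    unfolding ip by (simp add: algebra_simps)
  also have "\<dots> \<le> 2 * t * F + (1 + L * t) * (B * a)\<^sup>2 - b\<^sup>2 - n * c\<^sup>2 + n * (c\<^sup>2 + b\<^sup>2) + L * t * d * (a\<^sup>2 + b\<^sup>2)"
  proof -
    have "(\<beta> * a)\<^sup>2 \<le> (B * a)\<^sup>2"
      using assms by (simp add: power_mult_distrib mult_right_mono power_mono)
    then have "(1 + L * t) * (\<beta> * a)\<^sup>2 \<le> (1 + L * t) * (B * a)\<^sup>2"
      using assms by (intro mult_left_mono) auto
    moreover have "n * (2 * c * b) \<le> n * (c\<^sup>2 + b\<^sup>2)"
      using assms sum_squares_bound[of c b] by (intro mult_left_mono) auto
    moreover have "L * t * d * (2 * a * b) \<le> L * t * d * (a\<^sup>2 + b\<^sup>2)"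
      using assms sum_squares_bound[of a b] by (intro mult_left_mono) auto
    moreover have "n * c\<^sup>2 \<le> (1 - L * t) * c\<^sup>2"
      using assms by (intro mult_right_mono) auto
    ultimately show ?thesis
      by linarith
  qed
  also have "\<dots> = 2 * t * F + ((1 + L * t) * B\<^sup>2 + L * t * d) * a\<^sup>2 - (1 - n - L * t * d) * b\<^sup>2"
    by (simp add: algebra_simps power_mult_distrib)
  finally show ?thesis .
qed

text \<open>The mean value theorem gives an intermediate \<open>z < t\<close>, and
  \<open>u powr - p\<close> is nonincreasing. This serves the exponent
  \<open>p = max q (1 / 2)\<close>, which may differ from that of the given desingularizing
  function.\<close>

lemma powr_concave_tangent:
  fixes s t :: real
  assumes "0 < s" "s \<le> t" "0 \<le> p" "p \<le> 1"
  shows "(1 - p) * t powr - p * (t - s) \<le> t powr (1 - p) - s powr (1 - p)"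
proof (cases "s = t")
  case False
  then have "s < t"
    using assms by simp
  then obtain z where z: "s < z" "z < t"
    and eq: "t powr (1 - p) - s powr (1 - p) = (t - s) * ((1 - p) * z powr (1 - p - 1))"
    using MVT2[of s t "\<lambda>u. u powr (1 - p)" "\<lambda>u. (1 - p) * u powr (1 - p - 1)",
        OF _ has_real_derivative_powr] assms(1)
    by (meson less_le_trans)
  have "t powr - p \<le> z powr - p"
    using z assms by (intro powr_mono2') auto
  then have "(t - s) * ((1 - p) * t powr - p) \<le> (t - s) * ((1 - p) * z powr - p)"
    using assms by (intro mult_left_mono) auto
  then show ?thesis
    using eq by (simp add: mult_ac)
qed simp

text \<open>The upper bounds \<open>B\<close> and \<open>d\<close> will be instantiated by the
  suprema \<open>beta_bar\<close> and \<open>delta_bar\<close>.\<close>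

locale extragradient_momentum =
  fixes f :: "'a::euclidean_space \<Rightarrow> real" and g :: "'a \<Rightarrow> 'a" and x :: "nat \<Rightarrow> 'a"
    and \<beta> \<gamma> :: "nat \<Rightarrow> real" and B d L \<tau>1 \<tau>2 \<nu> :: real
  assumes gderiv: "\<And>z. GDERIV f z :> g z"
    and L: "0 < L"
    and lip: "\<And>y z. norm (g y - g z) \<le> L * norm (y - z)"
    and \<beta>: "\<And>k. 1 \<le> k \<Longrightarrow> 0 \<le> \<beta> k" "\<And>k. 1 \<le> k \<Longrightarrow> \<beta> k \<le> B"
    and d: "\<And>k. 1 \<le> k \<Longrightarrow> \<bar>\<beta> k - \<gamma> k\<bar> \<le> d"
    and \<tau>: "0 < \<tau>1" "0 < \<tau>2" "\<tau>2 \<le> \<nu> / (L * (\<nu> + 1))"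
    and \<nu>: "0 < \<nu>" "\<nu> < 1"
    and step_size: "L * \<tau>1 < 1 - \<nu>" "2 * L * \<tau>1 * d + (L * \<tau>1 + 1) * B\<^sup>2 < 1 - \<nu>"
    and update: "\<And>k. 1 \<le> k \<Longrightarrow> x (Suc k) =
        extrapolate \<beta> x k - \<tau>1 *\<^sub>R g (extrapolate \<gamma> x k - \<tau>2 *\<^sub>R g (extrapolate \<gamma> x k))"
    and nonstationary: "\<And>k. 1 \<le> k \<Longrightarrow> g (extrapolate \<gamma> x k) \<noteq> 0"
    and bdd: "bdd_below ((\<lambda>k. f (x k)) ` {1..})"
begin

section \<open>Energy descent\<close>

definition w :: "nat \<Rightarrow> 'a" where
  "w k = g (extrapolate \<gamma> x k - \<tau>2 *\<^sub>R g (extrapolate \<gamma> x k))"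

definition a :: "nat \<Rightarrow> real" where
  "a k = norm (x k - x (k - 1))"

text \<open>After division of \<open>energy_arith\<close> by \<open>2 * \<tau>1\<close>, the squared
  old step has coefficient \<open>A\<close> and the squared new step has coefficient
  \<open>A + \<kappa>\<close>; the second step size condition says exactly that the surplus
  \<open>\<kappa>\<close> is positive.\<close>

definition A :: real where
  "A = ((1 + L * \<tau>1) * B\<^sup>2 + L * \<tau>1 * d) / (2 * \<tau>1)"

definition \<kappa> :: real where
  "\<kappa> = ((1 - \<nu>) - (2 * L * \<tau>1 * d + (L * \<tau>1 + 1) * B\<^sup>2)) / (2 * \<tau>1)"

definition energy :: "nat \<Rightarrow> real" where
  "energy k = f (x k) + A * (a k)\<^sup>2"

lemma a_nonneg [simp]: "0 \<le> a k"
  by (simp add: a_def)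

lemma d_nonneg: "0 \<le> d"
  using d[of 1] by simp

lemma A_nonneg: "0 \<le> A"
  using L \<tau> d_nonneg by (simp add: A_def)

lemma \<kappa>_pos: "0 < \<kappa>"
  using step_size \<tau> by (simp add: \<kappa>_def)

text \<open>With \<open>c = \<nu> / (\<nu> + 1)\<close> the bound on \<open>\<tau>2\<close> gives \<open>\<parallel>w - g\<parallel> \<le> c \<parallel>g\<parallel>\<close>, and
  \<open>c / (1 - c) = \<nu>\<close>: the half step is an inexact gradient with relative error \<open>\<nu>\<close>.\<close>

lemma relative_error: "norm (w k - g (extrapolate \<gamma> x k)) \<le> \<nu> * norm (w k)"
proof -
  define y where "y = extrapolate \<gamma> x k"
  define e where "e = norm (w k - g y)"
  have "e \<le> L * norm (\<tau>2 *\<^sub>R g y)"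
    using lip[of "y - \<tau>2 *\<^sub>R g y" y] by (simp add: w_def y_def e_def)
  also have "\<dots> = L * \<tau>2 * norm (g y)"
    using \<tau> by simp
  also have "\<dots> \<le> L * (\<nu> / (L * (\<nu> + 1))) * norm (g y)"
    using L \<tau> by (intro mult_right_mono mult_left_mono) auto
  also have "\<dots> = \<nu> / (\<nu> + 1) * norm (g y)"
    using L by simp
  finally have "(\<nu> + 1) * e \<le> \<nu> * norm (g y)"
    using \<nu> by (simp add: field_simps)
  also have "\<dots> \<le> \<nu> * (norm (w k) + e)"
    using \<nu> norm_triangle_sub[of "g y" "w k"]
    by (intro mult_left_mono) (auto simp: e_def norm_minus_commute)
  finally show ?thesis
    by (simp add: algebra_simps e_def y_def)
qed

lemma momentum_eq:
  assumes "1 \<le> k"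
  shows "\<beta> k *\<^sub>R (x k - x (k - 1)) = \<tau>1 *\<^sub>R w k + (x (Suc k) - x k)"
  using update[OF assms] by (simp add: w_def extrapolate_def algebra_simps)

text \<open>Two errors add up: the half step contributes the relative error, and the mismatch of
  \<open>\<beta>\<close> and \<open>\<gamma>\<close> moves the extrapolated point by at most
  \<open>d * a k\<close>.\<close>

lemma gradient_error:
  assumes "1 \<le> k"
  shows "norm (g (extrapolate \<beta> x k) - w k) \<le> \<nu> * norm (w k) + L * d * a k"
proof -
  have "norm (g (extrapolate \<beta> x k) - g (extrapolate \<gamma> x k)) \<le> L * norm ((\<beta> k - \<gamma> k) *\<^sub>R (x k - x (k - 1)))"
    using lip[of "extrapolate \<beta> x k" "extrapolate \<gamma> x k"]
    by (simp add: extrapolate_def scaleR_diff_left)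
  also have "\<dots> = L * (\<bar>\<beta> k - \<gamma> k\<bar> * a k)"
    by (simp add: a_def)
  also have "\<dots> \<le> L * (d * a k)"
    using L d[OF assms] by (intro mult_left_mono mult_right_mono) auto
  finally have "norm (g (extrapolate \<beta> x k) - g (extrapolate \<gamma> x k)) \<le> L * d * a k"
    by simp
  then show ?thesis
    using relative_error[of k]
      norm_triangle_ineq[of "g (extrapolate \<beta> x k) - g (extrapolate \<gamma> x k)" "g (extrapolate \<gamma> x k) - w k"]
    by (simp add: norm_minus_commute)
qed

text \<open>Both quadratic bounds are expanded at the extrapolated point \<open>y\<close>, the upper
  one towards \<open>x (Suc k)\<close> and the lower one towards \<open>x k\<close>; the value
  \<open>f y\<close> cancels and the linear terms combine to \<open>g y \<bullet> s\<close>.\<close>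

lemma energy_descent:
  assumes k: "1 \<le> k"
  shows "\<kappa> * (a (Suc k))\<^sup>2 \<le> energy k - energy (Suc k)"
proof -
  define y where "y = extrapolate \<beta> x k"
  define s where "s = x (Suc k) - x k"
  define m where "m = \<beta> k *\<^sub>R (x k - x (k - 1))"
  have m: "m = \<tau>1 *\<^sub>R w k + s"
    using momentum_eq[OF k] by (simp add: m_def s_def)
  have y: "y = x k + m"
    by (simp add: y_def m_def extrapolate_def)
  have norm_m: "norm m = \<beta> k * a k" and norm_s: "norm s = a (Suc k)"
    using \<beta>(1)[OF k] by (simp_all add: m_def s_def a_def)
  have "f (x (Suc k)) \<le> f y + g y \<bullet> (x (Suc k) - y) + L / 2 * (norm (x (Suc k) - y))\<^sup>2"
    by (rule lipschitz_gradient_upper[OF gderiv lip])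
  moreover have "f y + g y \<bullet> (x k - y) - L / 2 * (norm (x k - y))\<^sup>2 \<le> f (x k)"
    by (rule lipschitz_gradient_lower[OF gderiv lip])
  moreover have "x (Suc k) - y = - (\<tau>1 *\<^sub>R w k)" "x k - y = - m"
    using m y by (simp_all add: s_def algebra_simps)
  moreover have "g y \<bullet> (- (\<tau>1 *\<^sub>R w k)) - g y \<bullet> (- m) = g y \<bullet> s"
    by (simp add: m inner_add_right inner_diff_right)
  ultimately have "f (x (Suc k)) \<le> f (x k) + g y \<bullet> s + L / 2 * ((norm (\<tau>1 *\<^sub>R w k))\<^sup>2 + (norm m)\<^sup>2)"
    by (simp add: algebra_simps)
  also have "g y \<bullet> s \<le> w k \<bullet> s + (\<nu> * norm (w k) + L * d * a k) * a (Suc k)"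
  proof -
    have "(g y - w k) \<bullet> s \<le> norm (g y - w k) * norm s"
      by (rule norm_cauchy_schwarz)
    also have "\<dots> \<le> (\<nu> * norm (w k) + L * d * a k) * a (Suc k)"
      using gradient_error[OF k] by (simp add: norm_s y_def mult_right_mono)
    finally show ?thesis
      by (simp add: inner_diff_left)
  qed
  finally have step: "f (x (Suc k)) \<le> f (x k) + w k \<bullet> s
      + (\<nu> * ((\<tau>1 * norm (w k)) / \<tau>1) + L * d * a k) * a (Suc k)
      + L / 2 * ((\<tau>1 * norm (w k))\<^sup>2 + (\<beta> k * a k)\<^sup>2)"
    using \<tau> by (simp add: norm_m)
  \<comment> \<open>Expanding the square expresses the inner product through three squared lengths,
    as the premise \<open>ip\<close> of \<open>energy_arith\<close> requires.\<close>
  have "(norm m)\<^sup>2 = (norm (\<tau>1 *\<^sub>R w k))\<^sup>2 + 2 * \<tau>1 * (w k \<bullet> s) + (norm s)\<^sup>2"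
    unfolding m power2_norm_eq_inner by (simp add: inner_add_left inner_add_right inner_commute)
  then have "2 * \<tau>1 * (w k \<bullet> s) = (\<beta> k * a k)\<^sup>2 - (a (Suc k))\<^sup>2 - (\<tau>1 * norm (w k))\<^sup>2"
    using \<tau> by (simp add: norm_m norm_s)
  from energy_arith[OF _ _ _ _ _ _ _ this step]
  have "2 * \<tau>1 * f (x (Suc k)) \<le> 2 * \<tau>1 * f (x k) + ((1 + L * \<tau>1) * B\<^sup>2 + L * \<tau>1 * d) * (a k)\<^sup>2
      - (1 - \<nu> - L * \<tau>1 * d) * (a (Suc k))\<^sup>2"
    using L \<nu> \<tau> step_size d_nonneg \<beta>[OF k] by simp
  moreover have "2 * \<tau>1 * A = (1 + L * \<tau>1) * B\<^sup>2 + L * \<tau>1 * d"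
    and "2 * \<tau>1 * (A + \<kappa>) = 1 - \<nu> - L * \<tau>1 * d"
    using \<tau> by (simp_all add: A_def \<kappa>_def field_simps)
  ultimately have "2 * \<tau>1 * f (x (Suc k)) \<le> 2 * \<tau>1 * f (x k) + 2 * \<tau>1 * A * (a k)\<^sup>2
      - 2 * \<tau>1 * (A + \<kappa>) * (a (Suc k))\<^sup>2"
    by metis
  then have "2 * \<tau>1 * (\<kappa> * (a (Suc k))\<^sup>2) \<le> 2 * \<tau>1 * (energy k - energy (Suc k))"
    by (simp add: energy_def algebra_simps)
  then show ?thesis
    using \<tau> by simp
qed

section \<open>Gradient bound and limits\<close>

definition C :: real where
  "C = L * B + L * d + (1 + \<nu>) * (B + 1) / \<tau>1"

lemma B_nonneg: "0 \<le> B"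
  using \<beta>[of 1] by simp

lemma C_pos: "0 < C"
  using L d_nonneg \<nu> \<tau> B_nonneg by (auto simp: C_def intro!: add_nonneg_pos divide_pos_pos mult_pos_pos)

text \<open>The update expresses \<open>w k\<close> by two consecutive steps;
  \<open>gradient_error\<close> and the Lipschitz bound carry this over to the gradient at
  \<open>x k\<close>.\<close>

lemma grad_bound:
  assumes k: "1 \<le> k"
  shows "norm (g (x k)) \<le> C * (a k + a (Suc k))"
proof -
  have "\<tau>1 *\<^sub>R w k = \<beta> k *\<^sub>R (x k - x (k - 1)) - (x (Suc k) - x k)"
    using momentum_eq[OF k] by simp
  then have "\<tau>1 * norm (w k) \<le> \<beta> k * a k + a (Suc k)"
    using norm_triangle_ineq4[of "\<beta> k *\<^sub>R (x k - x (k - 1))" "x (Suc k) - x k"] \<tau> \<beta>[OF k]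
    by (metis a_def abs_of_nonneg diff_Suc_1 less_imp_le norm_scaleR)
  also have "\<dots> \<le> (B + 1) * (a k + a (Suc k))"
    using mult_right_mono[OF \<beta>(2)[OF k], of "a k"] mult_nonneg_nonneg[OF B_nonneg, of "a (Suc k)"]
    by (simp add: algebra_simps add_increasing)
  finally have w: "norm (w k) \<le> (B + 1) / \<tau>1 * (a k + a (Suc k))"
    using \<tau> by (simp add: field_simps)
  have "norm (g (x k) - g (extrapolate \<beta> x k)) \<le> L * (\<beta> k * a k)"
    using lip[of "x k" "extrapolate \<beta> x k"] \<beta>[OF k] by (simp add: extrapolate_def a_def)
  also have "\<dots> \<le> L * (B * a k)"
    using L \<beta>[OF k] by (intro mult_left_mono mult_right_mono) auto
  finally have "norm (g (x k)) \<le> L * B * a k + (\<nu> * norm (w k) + L * d * a k) + norm (w k)"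
    using gradient_error[OF k] norm_triangle_sub[of "g (x k)" "g (extrapolate \<beta> x k)"]
      norm_triangle_sub[of "g (extrapolate \<beta> x k)" "w k"]
    by simp
  also have "\<dots> = (L * B + L * d) * a k + (1 + \<nu>) * norm (w k)"
    by (simp add: algebra_simps)
  also have "\<dots> \<le> (L * B + L * d) * (a k + a (Suc k)) + (1 + \<nu>) * ((B + 1) / \<tau>1 * (a k + a (Suc k)))"
    using L \<nu> d_nonneg B_nonneg w by (intro add_mono mult_left_mono) auto
  also have "\<dots> = C * (a k + a (Suc k))"
    by (simp add: C_def distrib_right)
  finally show ?thesis .
qed

lemma energy_decreasing:
  assumes "1 \<le> k" "k \<le> n"
  shows "energy n \<le> energy k"
  using assms(2)
proof (induction n rule: dec_induct)
  case (step n)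
  have "0 \<le> \<kappa> * (a (Suc n))\<^sup>2"
    using \<kappa>_pos by simp
  then show ?case
    using energy_descent[of n] step assms(1) by linarith
qed simp

lemma convergent_energy: "convergent energy"
proof -
  obtain b where b: "\<And>k. 1 \<le> k \<Longrightarrow> b \<le> f (x k)"
    using bdd by (auto simp: bdd_below_def)
  \<comment> \<open>The descent is available from index 1 on, hence the shift.\<close>
  have "b \<le> energy (Suc k)" for k
    using b[of "Suc k"] A_nonneg by (simp add: energy_def add_increasing2)
  moreover have "decseq (\<lambda>k. energy (Suc k))"
    using energy_decreasing by (auto simp: decseq_def)
  ultimately obtain l where "(\<lambda>k. energy (Suc k)) \<longlonglongrightarrow> l"
    using decseq_convergent by blast
  then show ?thesis
    using convergent_def LIMSEQ_imp_Suc by blast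
qed

lemma a_tendsto_0: "a \<longlonglongrightarrow> 0"
proof -
  have lim: "energy \<longlonglongrightarrow> lim energy"
    using convergent_energy by (simp add: convergent_LIMSEQ_iff)
  have "(\<lambda>k. (a (Suc k))\<^sup>2) \<longlonglongrightarrow> 0"
  proof (rule tendsto_sandwich[of "\<lambda>_. 0"])
    have "(\<lambda>k. (energy k - energy (Suc k)) / \<kappa>) \<longlonglongrightarrow> (lim energy - lim energy) / \<kappa>"
      using \<kappa>_pos by (intro tendsto_intros lim LIMSEQ_Suc) auto
    then show "(\<lambda>k. (energy k - energy (Suc k)) / \<kappa>) \<longlonglongrightarrow> 0"
      by simp
    show "eventually (\<lambda>k. (a (Suc k))\<^sup>2 \<le> (energy k - energy (Suc k)) / \<kappa>) sequentially"
      using energy_descent \<kappa>_pos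
      by (intro eventually_sequentiallyI[of 1]) (simp add: pos_le_divide_eq mult.commute)
  qed auto
  then have "(\<lambda>k. sqrt ((a (Suc k))\<^sup>2)) \<longlonglongrightarrow> sqrt 0"
    by (rule tendsto_real_sqrt)
  then show ?thesis
    by (simp add: LIMSEQ_imp_Suc)
qed

lemma grad_tendsto_0: "(\<lambda>k. g (x k)) \<longlonglongrightarrow> 0"
proof (rule Lim_null_comparison)
  show "eventually (\<lambda>k. norm (g (x k)) \<le> C * (a k + a (Suc k))) sequentially"
    using grad_bound by (intro eventually_sequentiallyI[of 1]) auto
  have "(\<lambda>k. C * (a k + a (Suc k))) \<longlonglongrightarrow> C * (0 + 0)"
    by (intro tendsto_intros a_tendsto_0 LIMSEQ_Suc)
  then show "(\<lambda>k. C * (a k + a (Suc k))) \<longlonglongrightarrow> 0"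
    by simp
qed

text \<open>The energy converges, so its limit can be read off along the subsequence, where the
  quadratic term vanishes and \<open>f\<close> is continuous.\<close>

lemma energy_tendsto:
  assumes "accumulation_point x z"
  shows "energy \<longlonglongrightarrow> f z"
proof -
  obtain r where r: "strict_mono r" "(x \<circ> r) \<longlonglongrightarrow> z"
    using assms by (auto simp: accumulation_point_def)
  have "isCont f z"
    using gderiv[of z] unfolding gderiv_def by (rule has_derivative_continuous)
  then have "(\<lambda>i. f ((x \<circ> r) i)) \<longlonglongrightarrow> f z"
    using r(2) by (rule isCont_tendsto_compose)
  moreover have "(\<lambda>i. A * ((a \<circ> r) i)\<^sup>2) \<longlonglongrightarrow> A * 0\<^sup>2"
    by (intro tendsto_intros LIMSEQ_subseq_LIMSEQ a_tendsto_0 r)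
  ultimately have "(\<lambda>i. f ((x \<circ> r) i) + A * ((a \<circ> r) i)\<^sup>2) \<longlonglongrightarrow> f z + A * 0\<^sup>2"
    by (rule tendsto_add)
  then have "(energy \<circ> r) \<longlonglongrightarrow> f z"
    by (simp add: energy_def comp_def)
  moreover obtain l where l: "energy \<longlonglongrightarrow> l"
    using convergent_energy by (auto simp: convergent_def)
  ultimately show ?thesis
    using LIMSEQ_subseq_LIMSEQ[OF l r(1)] LIMSEQ_unique by blast
qed

lemma stationary_of_tendsto:
  assumes "x \<longlonglongrightarrow> z"
  shows "g z = 0"
proof -
  have "(\<lambda>k. g (x k) - g z) \<longlonglongrightarrow> 0"
  proof (rule Lim_null_comparison)
    show "eventually (\<lambda>k. norm (g (x k) - g z) \<le> L * norm (x k - z)) sequentially"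
      using lip by simp
    show "(\<lambda>k. L * norm (x k - z)) \<longlonglongrightarrow> 0"
      using assms by (intro tendsto_mult_right_zero tendsto_norm_zero) (simp add: LIM_zero)
  qed
  then have "(\<lambda>k. g (x k)) \<longlonglongrightarrow> g z"
    by (rule LIM_zero_cancel)
  then show ?thesis
    using grad_tendsto_0 LIMSEQ_unique by blast
qed

section \<open>The energy gap and its PLK inequality\<close>

definition gap :: "'a \<Rightarrow> nat \<Rightarrow> real" where
  "gap z k = energy k - f z"

lemma gap_tendsto_0: "accumulation_point x z \<Longrightarrow> gap z \<longlonglongrightarrow> 0"
  unfolding gap_def[abs_def] using energy_tendsto by (simp add: LIM_zero)

lemma gap_decreasing: "1 \<le> k \<Longrightarrow> k \<le> n \<Longrightarrow> gap z n \<le> gap z k"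
  using energy_decreasing by (simp add: gap_def)

lemma gap_descent: "1 \<le> k \<Longrightarrow> \<kappa> * (a (Suc k))\<^sup>2 \<le> gap z k - gap z (Suc k)"
  using energy_descent by (simp add: gap_def)

text \<open>If the gap vanished at some \<open>k\<close>, the iterates would be constant from \<open>k\<close> on, hence
  \<open>w (Suc k) = 0\<close>, which \<open>nonstationary\<close> excludes.\<close>

lemma gap_pos:
  assumes "accumulation_point x z" "1 \<le> k"
  shows "0 < gap z k"
proof (rule ccontr)
  assume neg: "\<not> 0 < gap z k"
  have nonneg: "0 \<le> gap z n" if "1 \<le> n" for n
    using gap_tendsto_0[OF assms(1)] gap_decreasing[OF that]
    by (intro LIMSEQ_le_const2[where X = "gap z"]) auto
  have zero: "gap z n = 0" if "k \<le> n" for n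
    using gap_decreasing[OF assms(2) that, of z] nonneg[of n] neg assms(2) that by simp
  have a0: "a (Suc n) = 0" if "k \<le> n" for n
  proof -
    have "\<kappa> * (a (Suc n))\<^sup>2 \<le> 0"
      using gap_descent[of n z] zero[of n] zero[of "Suc n"] that assms(2) by simp
    then show ?thesis
      using \<kappa>_pos by (simp add: mult_le_0_iff)
  qed
  have "\<tau>1 *\<^sub>R w (Suc k) = 0"
    using momentum_eq[of "Suc k"] a0[of k] a0[of "Suc k"] by (simp add: a_def)
  then have "w (Suc k) = 0"
    using \<tau> by simp
  then have "g (extrapolate \<gamma> x (Suc k)) = 0"
    using relative_error[of "Suc k"] by simp
  then show False
    using nonstationary[of "Suc k"] by simp
qed

text \<open>Multiplying the descent by the slope condition bounds the squared new step by a product,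
  to which \<open>le_of_square_le_mult\<close> applies. With \<open>D\<close> and
  \<open>\<Phi>\<close> left arbitrary, this covers both the convergence proof and the power
  rates.\<close>

lemma potential_step:
  assumes k: "1 \<le> k" and slope: "1 \<le> D * (a k + a (Suc k))"
    and "D * (gap z k - gap z (Suc k)) \<le> \<Phi> - \<Phi>'"
  shows "2 * norm (x (Suc k) - x k) \<le> (a k + 4 / \<kappa> * \<Phi>) - (a (Suc k) + 4 / \<kappa> * \<Phi>')"
proof -
  have nonneg: "0 \<le> gap z k - gap z (Suc k)"
    using gap_decreasing[of k "Suc k" z] k by simp
  have "\<kappa> * (a (Suc k))\<^sup>2 \<le> gap z k - gap z (Suc k)"
    using gap_descent[OF k] .
  also have "\<dots> \<le> D * (a k + a (Suc k)) * (gap z k - gap z (Suc k))"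
    using mult_right_mono[OF slope nonneg] by simp
  also have "\<dots> \<le> (a k + a (Suc k)) * (\<Phi> - \<Phi>')"
    using mult_left_mono[OF assms(3), of "a k + a (Suc k)"] by (simp add: mult_ac)
  finally have "(a (Suc k))\<^sup>2 \<le> (a k + a (Suc k)) * ((\<Phi> - \<Phi>') / \<kappa>)"
    using \<kappa>_pos by (simp add: field_simps)
  \<comment> \<open>The slope condition forces \<open>D \<ge> 0\<close>, since step lengths are
    nonnegative.\<close>
  moreover have "0 \<le> \<Phi> - \<Phi>'"
  proof (rule order_trans[OF mult_nonneg_nonneg[OF _ nonneg] assms(3)])
    show "0 \<le> D"
      using slope a_nonneg[of k] a_nonneg[of "Suc k"]
      by (smt (verit) mult_nonneg_nonneg mult_nonpos_nonneg)
  qed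
  moreover define X where "X = (\<Phi> - \<Phi>') / \<kappa>"
  ultimately have "a (Suc k) \<le> (a k + a (Suc k)) / 4 + X"
    using \<kappa>_pos by (intro le_of_square_le_mult) auto
  then have "2 * a (Suc k) \<le> a k - a (Suc k) + 4 * X"
    by (simp add: field_simps)
  also have "4 * X = 4 / \<kappa> * \<Phi> - 4 / \<kappa> * \<Phi>'"
    by (simp add: X_def diff_divide_distrib)
  finally show ?thesis
    by (simp add: a_def)
qed

text \<open>The PLK inequality holds for \<open>f\<close> only, while \<open>gap\<close> also contains \<open>A * (a k)\<^sup>2\<close>. One of the two
  summands is at least half of the gap: either \<open>f (x k) - f z\<close>, and then PLK applies at
  \<open>gap z k / 2\<close> by monotonicity of the derivative of \<open>\<phi>\<close>, or \<open>A * (a k)\<^sup>2\<close>.\<close>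

lemma energy_PLK:
  assumes desing: "desingularizing \<eta> \<phi>" "ereal r \<le> \<eta>"
    and PLK: "\<And>y. y \<in> U \<Longrightarrow> f z < f y \<Longrightarrow> f y - f z < r \<Longrightarrow> 1 \<le> deriv \<phi> (f y - f z) * norm (g y)"
    and k: "1 \<le> k" and "x k \<in> U" and gap: "0 < gap z k" "gap z k < r"
  shows "1 \<le> (C * deriv \<phi> (gap z k / 2) + sqrt (2 * A) / sqrt (gap z k)) * (a k + a (Suc k))"
proof -
  have "ereal (gap z k / 2) < \<eta>"
    using gap desing(2) by (intro order_less_le_trans[OF _ desing(2)]) simp
  then have deriv_pos: "0 < deriv \<phi> (gap z k / 2)"
    using desing(1) gap by (simp add: desingularizing_def)
  show ?thesis
  proof (cases "gap z k / 2 \<le> f (x k) - f z")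
    case True
    have le: "f (x k) - f z \<le> gap z k"
      using A_nonneg by (simp add: gap_def energy_def)
    then have "1 \<le> deriv \<phi> (f (x k) - f z) * norm (g (x k))"
      using True gap assms(5) by (intro PLK) auto
    also have "\<dots> \<le> deriv \<phi> (gap z k / 2) * (C * (a k + a (Suc k)))"
      using deriv_pos True gap le grad_bound[OF k]
      by (intro mult_mono desingularizing_deriv_antimono[OF desing]) auto
    also have "\<dots> = C * deriv \<phi> (gap z k / 2) * (a k + a (Suc k))"
      by simp
    also have "\<dots> \<le> (C * deriv \<phi> (gap z k / 2) + sqrt (2 * A) / sqrt (gap z k)) * (a k + a (Suc k))"
      using A_nonneg gap by (intro mult_right_mono) auto
    finally show ?thesis .
  next
    case False
    then have "gap z k \<le> 2 * A * (a k)\<^sup>2"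
      by (simp add: gap_def energy_def field_simps)
    then have "sqrt (gap z k) \<le> sqrt (2 * A * (a k)\<^sup>2)"
      by (rule real_sqrt_le_mono)
    then have "sqrt (gap z k) \<le> sqrt (2 * A) * a k"
      by (simp add: real_sqrt_mult)
    then have "1 \<le> sqrt (2 * A) / sqrt (gap z k) * a k"
      using gap by (simp add: field_simps)
    also have "\<dots> \<le> (C * deriv \<phi> (gap z k / 2) + sqrt (2 * A) / sqrt (gap z k)) * (a k + a (Suc k))"
      using A_nonneg C_pos gap deriv_pos by (intro mult_mono) auto
    finally show ?thesis .
  qed
qed

text \<open>\<open>\<Phi>\<close> is chosen so that its derivative is the slope factor in
  \<open>energy_PLK\<close>; the resulting potential \<open>V\<close> feeds
  \<open>potential_trapping\<close>.\<close>

lemma convergence: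
  assumes acc: "accumulation_point x z"
    and desing: "desingularizing \<eta> \<phi>" "0 < r" "ereal r \<le> \<eta>" and U: "open U" "z \<in> U"
    and PLK: "\<And>y. y \<in> U \<Longrightarrow> f z < f y \<Longrightarrow> f y - f z < r \<Longrightarrow> 1 \<le> deriv \<phi> (f y - f z) * norm (g y)"
  shows "x \<longlonglongrightarrow> z"
proof -
  define \<Phi> where "\<Phi> t = 2 * C * \<phi> (t / 2) + 2 * sqrt (2 * A) * sqrt t" for t
  define V where "V k = a k + 4 / \<kappa> * \<Phi> (gap z k)" for k
  have "eventually (\<lambda>k. gap z k < r) sequentially"
    using gap_tendsto_0[OF acc] desing(2) by (rule order_tendstoD)
  then have "eventually (\<lambda>k. 1 \<le> k \<and> gap z k < r) sequentially"
    by (intro eventually_conj eventually_ge_at_top)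
  then obtain N where N: "1 \<le> N" "\<And>k. N \<le> k \<Longrightarrow> gap z k < r"
    unfolding eventually_sequentially by blast
  have \<Phi>_diff: "(C * deriv \<phi> (gap z k / 2) + sqrt (2 * A) / sqrt (gap z k)) * (gap z k - gap z (Suc k))
      \<le> \<Phi> (gap z k) - \<Phi> (gap z (Suc k))" if "N \<le> k" for k
  proof -
    define s t where "s = gap z (Suc k)" and "t = gap z k"
    have st: "0 < s" "s \<le> t" "t < r"
      using that N gap_pos[OF acc] gap_decreasing[of k "Suc k" z] by (auto simp: s_def t_def)
    \<comment> \<open>The factor \<open>2 * C\<close> in \<open>\<Phi>\<close> compensates the
      halved arguments.\<close>
    have "deriv \<phi> (t / 2) * (t / 2 - s / 2) \<le> \<phi> (t / 2) - \<phi> (s / 2)"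
      using st by (intro desingularizing_tangent[OF desing(1,3)]) auto
    then have "(2 * C) * (deriv \<phi> (t / 2) * (t / 2 - s / 2)) \<le> (2 * C) * (\<phi> (t / 2) - \<phi> (s / 2))"
      using C_pos by (intro mult_left_mono) auto
    \<comment> \<open>This is the tangent inequality for the square root.\<close>
    moreover have "t - s = (sqrt t - sqrt s) * (sqrt t + sqrt s)"
      using st by (simp add: algebra_simps)
    then have "t - s \<le> (sqrt t - sqrt s) * (2 * sqrt t)"
      using st by (simp add: mult_left_mono)
    then have "(t - s) / sqrt t \<le> 2 * (sqrt t - sqrt s)"
      using st by (simp add: pos_divide_le_eq mult_ac)
    then have "sqrt (2 * A) * ((t - s) / sqrt t) \<le> sqrt (2 * A) * (2 * (sqrt t - sqrt s))"
      using A_nonneg by (intro mult_left_mono) auto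
    ultimately show ?thesis
      unfolding \<Phi>_def s_def[symmetric] t_def[symmetric]
      by (simp add: algebra_simps diff_divide_distrib)
  qed
  have \<Phi>_nonneg: "0 \<le> \<Phi> (gap z k)" if "N \<le> k" for k
  proof -
    have "0 < gap z k" "gap z k < r"
      using that N gap_pos[OF acc] by auto
    moreover from this have "ereal (gap z k / 2) < \<eta>"
      by (intro order_less_le_trans[OF _ desing(3)]) simp
    ultimately have "0 \<le> \<phi> (gap z k / 2)"
      using desing(1) by (simp add: desingularizing_def)
    then show ?thesis
      using \<open>0 < gap z k\<close> C_pos A_nonneg by (simp add: \<Phi>_def)
  qed
  \<comment> \<open>Convergence of \<open>\<Phi> (gap z k)\<close> comes from monotonicity, since
    \<open>\<phi>\<close> may jump at 0.\<close>
  have "\<Phi> (gap z (Suc k)) \<le> \<Phi> (gap z k)" if "N \<le> k" for k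
  proof -
    have "0 \<le> (C * deriv \<phi> (gap z k / 2) + sqrt (2 * A) / sqrt (gap z k)) * (gap z k - gap z (Suc k))"
    proof (intro mult_nonneg_nonneg add_nonneg_nonneg divide_nonneg_nonneg)
      have "0 < gap z k" "gap z k < r"
        using that N gap_pos[OF acc] by auto
      moreover from this have "ereal (gap z k / 2) < \<eta>"
        by (intro order_less_le_trans[OF _ desing(3)]) simp
      ultimately show "0 \<le> deriv \<phi> (gap z k / 2)"
        using desing(1) by (simp add: desingularizing_def less_imp_le)
      show "0 \<le> gap z k - gap z (Suc k)"
        using that N gap_decreasing[of k "Suc k" z] by simp
      show "0 \<le> sqrt (gap z k)"
        using \<open>0 < gap z k\<close> by simp
    qed (use C_pos A_nonneg in auto)
    then show ?thesis
      using \<Phi>_diff[OF that] by linarith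
  qed
  then have "decseq (\<lambda>k. \<Phi> (gap z (k + N)))"
    by (intro decseq_SucI) simp
  then obtain l where "(\<lambda>k. \<Phi> (gap z (k + N))) \<longlonglongrightarrow> l"
    by (rule decseq_convergent[of _ 0]) (use \<Phi>_nonneg in auto)
  then have "(\<lambda>k. \<Phi> (gap z k)) \<longlonglongrightarrow> l"
    by (rule LIMSEQ_offset)
  then have "V \<longlonglongrightarrow> 0 + 4 / \<kappa> * l"
    unfolding V_def by (intro tendsto_intros a_tendsto_0)
  then have "convergent V"
    by (rule convergentI)
  moreover have "2 * norm (x (Suc k) - x k) \<le> V k - V (Suc k)" if "N \<le> k" "x k \<in> U" for k
    unfolding V_def
  proof (rule potential_step)
    show "1 \<le> (C * deriv \<phi> (gap z k / 2) + sqrt (2 * A) / sqrt (gap z k)) * (a k + a (Suc k))"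
      using that N gap_pos[OF acc] by (intro energy_PLK[OF desing(1,3) PLK]) auto
  qed (use that N \<Phi>_diff in auto)
  ultimately show ?thesis
    by (rule potential_trapping[OF U _ acc])
qed


section \<open>Convergence rates\<close>

lemma bigo_rates:
  assumes "x \<longlonglongrightarrow> z" and u: "(\<lambda>k. norm (x k - z)) \<in> O(u)"
  shows "(\<lambda>k. norm (g (x k))) \<in> O(u)" and "(\<lambda>k. f (x k) - f z) \<in> O(\<lambda>k. (u k)\<^sup>2)"
proof -
  have gz: "g z = 0"
    using assms(1) by (rule stationary_of_tendsto)
  have "(\<lambda>k. norm (g (x k))) \<in> O(\<lambda>k. norm (x k - z))"
    using lip[of _ z] gz by (intro bigoI[of _ L]) simp
  then show "(\<lambda>k. norm (g (x k))) \<in> O(u)"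
    using u by (rule landau_o.big_trans)
  \<comment> \<open>Since \<open>g z = 0\<close>, only the quadratic terms of both bounds
    remain.\<close>
  have "\<bar>f y - f z\<bar> \<le> L / 2 * (norm (y - z))\<^sup>2" for y
    using lipschitz_gradient_upper[OF gderiv lip, of y z] lipschitz_gradient_lower[OF gderiv lip, of z y]
    by (intro abs_leI) (simp_all add: gz algebra_simps)
  then have "(\<lambda>k. f (x k) - f z) \<in> O(\<lambda>k. (norm (x k - z))\<^sup>2)"
    by (intro bigoI[of _ "L / 2"]) simp
  also have "(\<lambda>k. (norm (x k - z))\<^sup>2) \<in> O(\<lambda>k. (u k)\<^sup>2)"
    using landau_o.big.mult[OF u u] by (simp add: power2_eq_square)
  finally show "(\<lambda>k. f (x k) - f z) \<in> O(\<lambda>k. (u k)\<^sup>2)" .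
qed

text \<open>The energy behaves like a function of exponent \<open>p \<ge> 1 / 2\<close>, whatever \<open>q\<close> is: the term
  \<open>A * (a k)\<^sup>2\<close> is quadratic, and \<open>t powr - q \<le> t powr - p\<close> for \<open>t \<le> 1\<close>.\<close>

lemma power_slope:
  assumes lim: "x \<longlonglongrightarrow> z" and M: "0 < M" and q: "0 \<le> q" "q < 1" and p: "p = max q (1 / 2)"
    and desing: "desingularizing \<eta> (\<lambda>t. M * t powr (1 - q))" "0 < r" "ereal r \<le> \<eta>" and U: "open U" "z \<in> U"
    and PLK: "\<And>y. y \<in> U \<Longrightarrow> f z < f y \<Longrightarrow> f y - f z < r \<Longrightarrow>
      1 \<le> deriv (\<lambda>t. M * t powr (1 - q)) (f y - f z) * norm (g y)"
  obtains c where "0 < c"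
    "eventually (\<lambda>k. 1 \<le> c * gap z k powr - p * (a k + a (Suc k))) sequentially"
proof -
  define c where "c = 2 * C * M * (1 - q) + sqrt (2 * A)"
  have acc: "accumulation_point x z"
    using lim unfolding accumulation_point_def by (intro exI[of _ id]) (auto simp: strict_mono_id)
  have "0 < c"
    using C_pos M q A_nonneg by (auto simp: c_def intro!: add_pos_nonneg)
  moreover have "eventually (\<lambda>k. 1 \<le> c * gap z k powr - p * (a k + a (Suc k))) sequentially"
    using eventually_ge_at_top[of 1] topological_tendstoD[OF lim U]
      order_tendstoD(2)[OF gap_tendsto_0[OF acc] desing(2)]
      order_tendstoD(2)[OF gap_tendsto_0[OF acc], of 1, simplified]
  proof eventually_elim
    case (elim k)
    define t where "t = gap z k"
    have t: "0 < t" "t < r" "t < 1"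
      using elim gap_pos[OF acc] by (auto simp: t_def)
    have "((\<lambda>t. M * t powr (1 - q)) has_real_derivative M * ((1 - q) * (t / 2) powr (1 - q - 1))) (at (t / 2))"
      using t by (intro DERIV_cmult has_real_derivative_powr) simp
    then have "deriv (\<lambda>t. M * t powr (1 - q)) (t / 2) = M * (1 - q) * (t / 2) powr - q"
      by (simp add: DERIV_imp_deriv)
    also have "\<dots> = M * (1 - q) * (2 powr q * t powr - q)"
      using t by (simp add: powr_divide powr_minus field_simps)
    also have "\<dots> \<le> M * (1 - q) * (2 powr 1 * t powr - p)"
      using M q p t by (intro mult_left_mono mult_mono powr_mono powr_mono') auto
    finally have "C * deriv (\<lambda>t. M * t powr (1 - q)) (t / 2) \<le> C * (M * (1 - q) * (2 powr 1 * t powr - p))"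
      using C_pos by (intro mult_left_mono) auto
    then have "C * deriv (\<lambda>t. M * t powr (1 - q)) (t / 2) \<le> 2 * C * M * (1 - q) * t powr - p"
      by (simp add: mult_ac)
    moreover have "1 / sqrt t = t powr - (1 / 2)"
      using powr_half_sqrt[of t] t powr_minus_divide[of t "1 / 2"] by simp
    moreover have "t powr - (1 / 2) \<le> t powr - p"
      using p t by (intro powr_mono') auto
    ultimately have "C * deriv (\<lambda>t. M * t powr (1 - q)) (t / 2) + sqrt (2 * A) * (1 / sqrt t) \<le> c * t powr - p"
      using A_nonneg unfolding c_def distrib_right by (intro add_mono mult_left_mono) auto
    then have "(C * deriv (\<lambda>t. M * t powr (1 - q)) (t / 2) + sqrt (2 * A) / sqrt t) * (a k + a (Suc k))
        \<le> c * t powr - p * (a k + a (Suc k))"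
      by (intro mult_right_mono) auto
    moreover have "1 \<le> (C * deriv (\<lambda>t. M * t powr (1 - q)) (t / 2) + sqrt (2 * A) / sqrt t) * (a k + a (Suc k))"
      unfolding t_def using elim t by (intro energy_PLK[OF desing(1,3) PLK]) (auto simp: t_def)
    ultimately show ?case
      unfolding t_def[symmetric] by (rule order_trans[rotated])
  qed
  ultimately show thesis
    using that by blast
qed

text \<open>The slope condition at \<open>k + 1\<close> involves two steps, each paid for by one
  decrease of the gap. The two decreases add up to \<open>gap z k - gap z (k + 2)\<close>, which is
  \<open>S k - S (k + 1)\<close>; hence the recursion is stated for sums of consecutive
  gaps.\<close>

lemma gap_recursion:
  assumes acc: "accumulation_point x z" and p: "1 / 2 \<le> p" "p < 1" and "0 < c"
    and slope: "eventually (\<lambda>k. 1 \<le> c * gap z k powr - p * (a k + a (Suc k))) sequentially"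
  defines "S \<equiv> \<lambda>k. gap z k + gap z (Suc k)"
  obtains D where "0 < D" "eventually (\<lambda>k. S (Suc k) powr (2 * p) \<le> D * (S k - S (Suc k))) sequentially"
proof -
  have "eventually (\<lambda>k. S (Suc k) powr (2 * p) \<le> 2 powr (2 * p) * (2 * c\<^sup>2 / \<kappa>) * (S k - S (Suc k))) sequentially"
    using eventually_ge_at_top[of 1] eventually_sequentially_Suc[THEN iffD2, OF slope]
  proof eventually_elim
    case (elim k)
    define t where "t = gap z (Suc k)"
    have t: "0 < t"
      using gap_pos[OF acc] by (simp add: t_def)
    have "t powr p \<le> t powr p * (c * t powr - p * (a (Suc k) + a (Suc (Suc k))))"
      using elim t by (simp add: t_def)
    also have "\<dots> = c * (a (Suc k) + a (Suc (Suc k)))"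
      using t by (simp add: powr_minus)
    finally have "(t powr p)\<^sup>2 \<le> (c * (a (Suc k) + a (Suc (Suc k))))\<^sup>2"
      by (intro power_mono) auto
    also have "\<dots> = c\<^sup>2 * (a (Suc k) + a (Suc (Suc k)))\<^sup>2"
      by (simp add: power_mult_distrib)
    also have "\<dots> \<le> c\<^sup>2 * (2 * ((a (Suc k))\<^sup>2 + (a (Suc (Suc k)))\<^sup>2))"
      using sum_squares_bound[of "a (Suc k)" "a (Suc (Suc k))"]
      by (intro mult_left_mono) (auto simp: power2_sum)
    also have "\<dots> = 2 * c\<^sup>2 / \<kappa> * (\<kappa> * (a (Suc k))\<^sup>2 + \<kappa> * (a (Suc (Suc k)))\<^sup>2)"
      using \<kappa>_pos by (simp add: field_simps)
    also have "\<dots> \<le> 2 * c\<^sup>2 / \<kappa> * (S k - S (Suc k))"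
      using gap_descent[of k z] gap_descent[of "Suc k" z] elim \<kappa>_pos
      by (intro mult_left_mono) (auto simp: S_def)
    finally have t_le: "t powr (2 * p) \<le> 2 * c\<^sup>2 / \<kappa> * (S k - S (Suc k))"
      by (simp add: powr_add[symmetric] power2_eq_square)
    \<comment> \<open>Monotonicity of the gap replaces \<open>t\<close> by \<open>S (Suc k)\<close>
      at the cost of the factor \<open>2 powr (2 * p)\<close>.\<close>
    have "S (Suc k) \<le> 2 * t" "0 < S (Suc k)"
      using gap_decreasing[of "Suc k" "Suc (Suc k)" z] gap_pos[OF acc, of "Suc k"] gap_pos[OF acc, of "Suc (Suc k)"]
      by (auto simp: S_def t_def)
    then have "S (Suc k) powr (2 * p) \<le> (2 * t) powr (2 * p)"
      using p by (intro powr_mono2) auto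
    also have "\<dots> = 2 powr (2 * p) * t powr (2 * p)"
      using t by (simp add: powr_mult)
    also have "\<dots> \<le> 2 powr (2 * p) * (2 * c\<^sup>2 / \<kappa> * (S k - S (Suc k)))"
      using t_le by (intro mult_left_mono) auto
    finally show ?case
      by simp
  qed
  then show thesis
    using that[of "2 powr (2 * p) * (2 * c\<^sup>2 / \<kappa>)"] \<open>0 < c\<close> \<kappa>_pos by simp
qed

text \<open>The function \<open>c / (1 - p) * t powr (1 - p)\<close> has derivative
  \<open>c * t powr - p\<close>, so it yields a potential \<open>V\<close> that bounds the distance
  to the limit. The sum of gaps dominates both parts of \<open>V (Suc k)\<close>.\<close>

lemma iterate_bigo_gap:
  assumes lim: "x \<longlonglongrightarrow> z" and acc: "accumulation_point x z" and p: "1 / 2 \<le> p" "p < 1" and "0 < c"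
    and slope: "eventually (\<lambda>k. 1 \<le> c * gap z k powr - p * (a k + a (Suc k))) sequentially"
  shows "(\<lambda>k. norm (x (Suc k) - z)) \<in> O(\<lambda>k. (gap z k + gap z (Suc k)) powr (1 - p))"
proof -
  define V where "V k = a k + 4 / \<kappa> * (c / (1 - p) * gap z k powr (1 - p))" for k
  have "eventually (\<lambda>k. 2 * norm (x (Suc k) - x k) \<le> V k - V (Suc k)) sequentially"
    using eventually_ge_at_top[of 1] slope
  proof eventually_elim
    case (elim k)
    define s t where "s = gap z (Suc k)" and "t = gap z k"
    have st: "0 < s" "s \<le> t"
      using elim gap_pos[OF acc] gap_decreasing[of k "Suc k" z] by (auto simp: s_def t_def)
    have "(1 - p) * t powr - p * (t - s) \<le> t powr (1 - p) - s powr (1 - p)"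
      using st p by (intro powr_concave_tangent) auto
    then have "c / (1 - p) * ((1 - p) * t powr - p * (t - s)) \<le> c / (1 - p) * (t powr (1 - p) - s powr (1 - p))"
      using p \<open>0 < c\<close> by (intro mult_left_mono) auto
    then have "c * t powr - p * (t - s) \<le> c / (1 - p) * t powr (1 - p) - c / (1 - p) * s powr (1 - p)"
      using p by (simp add: right_diff_distrib)
    then show ?case
      unfolding V_def s_def t_def using elim by (intro potential_step)
  qed
  then have bound: "eventually (\<lambda>k. 2 * norm (x k - z) \<le> V k) sequentially"
    using p \<open>0 < c\<close> \<kappa>_pos by (intro potential_limit_bound lim) (auto simp: V_def)
  define D where "D = (1 / sqrt \<kappa> + 4 / \<kappa> * (c / (1 - p))) / 2"
  have "eventually (\<lambda>k. norm (norm (x (Suc k) - z)) \<le> D * norm ((gap z k + gap z (Suc k)) powr (1 - p))) sequentially"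
    using eventually_ge_at_top[of 1] eventually_sequentially_Suc[THEN iffD2, OF bound]
      order_tendstoD(2)[OF gap_tendsto_0[OF acc], of 1, simplified]
  proof eventually_elim
    case (elim k)
    define s t where "s = gap z (Suc k)" and "t = gap z k"
    have st: "0 < s" "0 < t" "t < 1"
      using elim gap_pos[OF acc] by (auto simp: s_def t_def)
    \<comment> \<open>The step is of order the square root of the previous gap, which is below the
      power \<open>1 - p \<le> 1 / 2\<close> as the gap is less than 1.\<close>
    have "\<kappa> * (a (Suc k))\<^sup>2 \<le> t"
      using gap_descent[of k z] elim st by (simp add: s_def t_def)
    then have "sqrt (\<kappa> * (a (Suc k))\<^sup>2) \<le> sqrt t"
      by (rule real_sqrt_le_mono)
    then have "a (Suc k) \<le> 1 / sqrt \<kappa> * sqrt t"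
      using \<kappa>_pos by (simp add: real_sqrt_mult field_simps)
    also have "sqrt t = t powr (1 / 2)"
      using st by (simp add: powr_half_sqrt)
    also have "\<dots> \<le> t powr (1 - p)"
      using st p by (intro powr_mono') auto
    also have "\<dots> \<le> (t + s) powr (1 - p)"
      using st p by (intro powr_mono2) auto
    finally have "a (Suc k) \<le> 1 / sqrt \<kappa> * (t + s) powr (1 - p)"
      using \<kappa>_pos by (simp add: divide_right_mono)
    moreover have "4 / \<kappa> * (c / (1 - p) * s powr (1 - p)) \<le> 4 / \<kappa> * (c / (1 - p) * (t + s) powr (1 - p))"
      using st p \<open>0 < c\<close> \<kappa>_pos by (intro mult_left_mono powr_mono2) auto
    moreover have "2 * norm (x (Suc k) - z) \<le> a (Suc k) + 4 / \<kappa> * (c / (1 - p) * s powr (1 - p))"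
      using elim by (simp add: V_def s_def)
    ultimately have "2 * norm (x (Suc k) - z) \<le> 2 * (D * (t + s) powr (1 - p))"
      by (simp add: D_def distrib_right)
    then show ?case
      by (simp add: s_def t_def)
  qed
  then show ?thesis
    by (rule bigoI)
qed

lemma gap_sum_tendsto_0:
  assumes "accumulation_point x z"
  shows "(\<lambda>k. gap z k + gap z (Suc k)) \<longlonglongrightarrow> 0"
  using tendsto_add[OF gap_tendsto_0[OF assms] LIMSEQ_Suc[OF gap_tendsto_0[OF assms]]] by simp

lemma eventually_gap_sum_pos:
  assumes "accumulation_point x z"
  shows "eventually (\<lambda>k. 0 < gap z k + gap z (Suc k)) sequentially"
  using gap_pos[OF assms] by (intro eventually_sequentiallyI[of 1] add_pos_pos) auto

lemma iterate_linear_rate: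
  assumes "x \<longlonglongrightarrow> z" and acc: "accumulation_point x z" and "0 < c"
    and slope: "eventually (\<lambda>k. 1 \<le> c * gap z k powr - (1 / 2) * (a k + a (Suc k))) sequentially"
  obtains \<mu> where "0 < \<mu>" "\<mu> < 1" "(\<lambda>k. norm (x k - z)) \<in> O(\<lambda>k. \<mu> ^ k)"
proof -
  define S where "S k = gap z k + gap z (Suc k)" for k
  obtain D where D: "0 < D" "eventually (\<lambda>k. S (Suc k) powr (2 * (1 / 2)) \<le> D * (S k - S (Suc k))) sequentially"
    using gap_recursion[OF acc _ _ \<open>0 < c\<close> slope] unfolding S_def by auto
  \<comment> \<open>For \<open>p = 1 / 2\<close> the recursion is linear with ratio
    \<open>D / (1 + D)\<close>; distances are of order \<open>sqrt (S k)\<close>, hence the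
    root.\<close>
  define \<mu> where "\<mu> = sqrt (D / (1 + D))"
  have \<mu>: "0 < \<mu>" "\<mu> < 1"
    using \<open>0 < D\<close> by (auto simp: \<mu>_def)
  have pos: "eventually (\<lambda>k. 0 < S k) sequentially"
    unfolding S_def by (rule eventually_gap_sum_pos[OF acc])
  have "(\<lambda>k. sqrt (S k)) \<in> O(\<lambda>k. \<mu> ^ k)"
  proof (rule linear_recursion_bigo)
    show "eventually (\<lambda>k. 0 < sqrt (S k)) sequentially"
      using pos by simp
    show "eventually (\<lambda>k. sqrt (S (Suc k)) \<le> \<mu> * sqrt (S k)) sequentially"
      using D(2) eventually_sequentially_Suc[THEN iffD2, OF pos]
    proof eventually_elim
      case (elim k)
      then have "S (Suc k) \<le> D / (1 + D) * S k"
        using \<open>0 < D\<close> by (simp add: field_simps)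
      then have "sqrt (S (Suc k)) \<le> sqrt (D / (1 + D) * S k)"
        by (rule real_sqrt_le_mono)
      then show ?case
        unfolding \<mu>_def real_sqrt_mult .
    qed
  qed (rule \<mu>)
  moreover have "(\<lambda>k. norm (x (Suc k) - z)) \<in> O(\<lambda>k. sqrt (S k))"
  proof -
    have "(\<lambda>k. norm (x (Suc k) - z)) \<in> O(\<lambda>k. S k powr (1 - 1 / 2))"
      unfolding S_def by (rule iterate_bigo_gap[OF assms(1) acc _ _ \<open>0 < c\<close> slope]) auto
    also have "(\<lambda>k. S k powr (1 - 1 / 2)) \<in> \<Theta>(\<lambda>k. sqrt (S k))"
      using pos by (intro bigthetaI_cong) (auto elim!: eventually_mono simp: powr_half_sqrt)
    finally show ?thesis .
  qed
  ultimately have "(\<lambda>k. norm (x (Suc k) - z)) \<in> O(\<lambda>k. \<mu> ^ k)"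
    using landau_o.big_trans by blast
  moreover have "(\<lambda>k. \<mu> ^ k) \<in> O(\<lambda>k. \<mu> ^ Suc k)"
    using \<mu> by (intro bigoI[of _ "1 / \<mu>"]) simp
  ultimately have "(\<lambda>k. norm (x k - z)) \<in> O(\<lambda>k. \<mu> ^ k)"
    by (rule bigo_unshift)
  with \<mu> show thesis
    by (rule that)
qed

lemma iterate_powr_rate:
  assumes "x \<longlonglongrightarrow> z" and acc: "accumulation_point x z" and "0 < c" and p: "1 / 2 < p" "p < 1"
    and slope: "eventually (\<lambda>k. 1 \<le> c * gap z k powr - p * (a k + a (Suc k))) sequentially"
  shows "(\<lambda>k. norm (x k - z)) \<in> O(\<lambda>k. real k powr - ((1 - p) / (2 * p - 1)))"
proof (rule bigo_unshift)
  define S where "S k = gap z k + gap z (Suc k)" for k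
  obtain D where D: "0 < D" "eventually (\<lambda>k. S (Suc k) powr (2 * p) \<le> D * (S k - S (Suc k))) sequentially"
    using gap_recursion[OF acc _ p(2) \<open>0 < c\<close> slope] p unfolding S_def by auto
  have pos: "eventually (\<lambda>k. 0 < S k) sequentially"
    unfolding S_def by (rule eventually_gap_sum_pos[OF acc])
  \<comment> \<open>The recursion has \<open>\<theta> = 2 * p\<close>; raising the rate to the power
    \<open>1 - p\<close> gives that of the iterates.\<close>
  have "S \<in> O(\<lambda>k. real k powr - (1 / (2 * p - 1)))"
    using p D pos gap_sum_tendsto_0[OF acc]
    by (intro powr_recursion_bigo) (auto simp: S_def[abs_def])
  then have "(\<lambda>k. S k powr (1 - p)) \<in> O(\<lambda>k. (real k powr - (1 / (2 * p - 1))) powr (1 - p))"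
    using p pos by (intro bigo_powr_nonneg) (auto elim!: eventually_mono)
  moreover have "(\<lambda>k. norm (x (Suc k) - z)) \<in> O(\<lambda>k. S k powr (1 - p))"
    unfolding S_def using p by (intro iterate_bigo_gap[OF assms(1) acc _ _ \<open>0 < c\<close> slope]) auto
  ultimately show "(\<lambda>k. norm (x (Suc k) - z)) \<in> O(\<lambda>k. real k powr - ((1 - p) / (2 * p - 1)))"
    using landau_o.big_trans by (fastforce simp: powr_powr)
  show "(\<lambda>k. real k powr - ((1 - p) / (2 * p - 1))) \<in> O(\<lambda>k. real (Suc k) powr - ((1 - p) / (2 * p - 1)))"
    using p by (intro powr_bigo_Suc) simp
qed

end

theorem theorem4p1:
  fixes f :: "real ^ 'n \<Rightarrow> real"
    and x :: "nat \<Rightarrow> real ^ 'n"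
    and \<beta> \<gamma> :: "nat \<Rightarrow> real"
    and L \<tau>1 \<tau>2 \<nu> :: real
  assumes "C1_function f"
    and "0 < L"
    and "\<forall>y z. norm (grad f y - grad f z) \<le> L * norm (y - z)"
    and "EGm f \<beta> \<gamma> \<tau>1 \<tau>2 x"
    and "0 < \<nu>" and "\<nu> < 1"
    and "\<tau>2 \<le> \<nu> / (L * (\<nu> + 1))"
    and "max (L * \<tau>1) (2 * L * \<tau>1 * delta_bar \<beta> \<gamma> + (L * \<tau>1 + 1) * (beta_bar \<beta>)\<^sup>2) < 1 - \<nu>"
    and "\<forall>k\<ge>1. grad f (extrapolate \<gamma> x k) \<noteq> 0"
    and "bdd_below ((\<lambda>k. f (x k)) ` {1..})"
  shows "(\<lambda>k. grad f (x k)) \<longlonglongrightarrow> 0 \<and>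
    (\<forall>xbar. accumulation_point x xbar \<and> basic_PLK f xbar \<longrightarrow>
       x \<longlonglongrightarrow> xbar \<and> stationary_point f xbar) \<and>
    (\<forall>xbar M q. accumulation_point x xbar \<and> 0 < M \<and> 0 \<le> q \<and> q < 1 \<and>
       PLK_with f xbar (\<lambda>t. M * t powr (1 - q)) \<longrightarrow>
       (q \<le> 1/2 \<longrightarrow>
          converges_linearly x xbar \<and>
          converges_linearly (\<lambda>k. grad f (x k)) 0 \<and>
          converges_linearly (\<lambda>k. f (x k)) (f xbar)) \<and>
       (1/2 < q \<longrightarrow>
          (\<lambda>k. norm (x k - xbar)) \<in> O(\<lambda>k. real k powr (- ((1 - q) / (2 * q - 1)))) \<and>
          (\<lambda>k. norm (grad f (x k))) \<in> O(\<lambda>k. real k powr (- ((1 - q) / (2 * q - 1)))) \<and>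
          (\<lambda>k. f (x k) - f xbar) \<in> O(\<lambda>k. real k powr (- ((2 - 2 * q) / (2 * q - 1))))))"
proof -
  have gderiv: "GDERIV f z :> grad f z" for z
    using assms(1) by (simp add: C1_function_def differentiable_imp_gderiv_grad)
  note EGm = assms(4)[unfolded EGm_def]
  \<comment> \<open>The \<open>bdd_above\<close> parts of \<open>EGm\<close> make the suprema
    genuine upper bounds.\<close>
  interpret extragradient_momentum f "grad f" x \<beta> \<gamma> "beta_bar \<beta>" "delta_bar \<beta> \<gamma>" L \<tau>1 \<tau>2 \<nu>
  proof
    show "\<beta> k \<le> beta_bar \<beta>" if "1 \<le> k" for k
      unfolding beta_bar_def using EGm that by (intro cSUP_upper) auto
    show "\<bar>\<beta> k - \<gamma> k\<bar> \<le> delta_bar \<beta> \<gamma>" if "1 \<le> k" for k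
      unfolding delta_bar_def using EGm that by (intro cSUP_upper) auto
  qed (use assms EGm gderiv in auto)
  have conv: "x \<longlonglongrightarrow> z" if acc: "accumulation_point x z" and plk: "PLK_with f z \<phi>" for z \<phi>
  proof -
    obtain r \<eta> U where r: "0 < r" "ereal r \<le> \<eta>" and desing: "desingularizing \<eta> \<phi>"
      and U: "open U" "z \<in> U" and PLK: "\<And>y. y \<in> U \<Longrightarrow> f z < f y \<Longrightarrow> f y - f z < r \<Longrightarrow> 1 \<le> deriv \<phi> (f y - f z) * norm (grad f y)"
      by (rule PLK_withE[OF plk]) (rule that)
    show ?thesis
      by (rule convergence[OF acc desing r U PLK])
  qed
  have slope: "\<exists>c>0. eventually (\<lambda>k. 1 \<le> c * gap z k powr - (max q (1 / 2)) * (a k + a (Suc k))) sequentially"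
    if acc: "accumulation_point x z" and Mq: "0 < M" "0 \<le> q" "q < 1" and plk: "PLK_with f z (\<lambda>t. M * t powr (1 - q))" for z M q
  proof -
    obtain r \<eta> U where r: "0 < r" "ereal r \<le> \<eta>"
      and desing: "desingularizing \<eta> (\<lambda>t. M * t powr (1 - q))"
      and U: "open U" "z \<in> U" and PLK: "\<And>y. y \<in> U \<Longrightarrow> f z < f y \<Longrightarrow> f y - f z < r \<Longrightarrow>
        1 \<le> deriv (\<lambda>t. M * t powr (1 - q)) (f y - f z) * norm (grad f y)"
      by (rule PLK_withE[OF plk]) (rule that)
    show ?thesis
      by (rule power_slope[OF conv[OF acc plk] Mq refl desing r U PLK]) auto
  qed
  have linear: "converges_linearly x z \<and> converges_linearly (\<lambda>k. grad f (x k)) 0 \<and>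
      converges_linearly (\<lambda>k. f (x k)) (f z)"
    if acc: "accumulation_point x z" and Mq: "0 < M" "0 \<le> q" "q < 1" and plk: "PLK_with f z (\<lambda>t. M * t powr (1 - q))"
      and q: "q \<le> 1 / 2" for z M q
  proof -
    have lim: "x \<longlonglongrightarrow> z"
      using acc plk by (rule conv)
    obtain c where "0 < c"
      "eventually (\<lambda>k. 1 \<le> c * gap z k powr - (1 / 2) * (a k + a (Suc k))) sequentially"
      using slope[OF acc Mq plk] q by (auto simp: max_absorb2)
    then obtain \<mu> where \<mu>: "0 < \<mu>" "\<mu> < 1" and rate: "(\<lambda>k. norm (x k - z)) \<in> O(\<lambda>k. \<mu> ^ k)"
      using iterate_linear_rate[OF lim acc] by blast
    \<comment> \<open>Values are quadratic in the distance, so their ratio is the square of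
      \<open>\<mu>\<close>.\<close>
    have "(\<lambda>k. norm (f (x k) - f z)) \<in> O(\<lambda>k. (\<mu>\<^sup>2) ^ k)"
      using bigo_rates(2)[OF lim rate] by (simp add: power_mult[symmetric] mult.commute)
    moreover have "0 < \<mu>\<^sup>2" "\<mu>\<^sup>2 < 1"
      using \<mu> by (simp_all add: power_less_one_iff)
    ultimately have "converges_linearly (\<lambda>k. f (x k)) (f z)"
      unfolding converges_linearly_def by blast
    then show ?thesis
      using \<mu> rate bigo_rates(1)[OF lim rate] by (auto simp: converges_linearly_def)
  qed
  have powr: "(\<lambda>k. norm (x k - z)) \<in> O(\<lambda>k. real k powr (- ((1 - q) / (2 * q - 1)))) \<and>
      (\<lambda>k. norm (grad f (x k))) \<in> O(\<lambda>k. real k powr (- ((1 - q) / (2 * q - 1)))) \<and>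
      (\<lambda>k. f (x k) - f z) \<in> O(\<lambda>k. real k powr (- ((2 - 2 * q) / (2 * q - 1))))"
    if acc: "accumulation_point x z" and Mq: "0 < M" "0 \<le> q" "q < 1" and plk: "PLK_with f z (\<lambda>t. M * t powr (1 - q))"
      and q: "1 / 2 < q" for z M q
  proof -
    have lim: "x \<longlonglongrightarrow> z"
      using acc plk by (rule conv)
    obtain c where "0 < c"
      "eventually (\<lambda>k. 1 \<le> c * gap z k powr - q * (a k + a (Suc k))) sequentially"
      using slope[OF acc Mq plk] q by (auto simp: max_absorb1)
    then have rate: "(\<lambda>k. norm (x k - z)) \<in> O(\<lambda>k. real k powr (- ((1 - q) / (2 * q - 1))))"
      using iterate_powr_rate[OF lim acc] q Mq by blast
    have "(real k powr (- ((1 - q) / (2 * q - 1))))\<^sup>2 = real k powr (- ((2 - 2 * q) / (2 * q - 1)))" for k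
      by (simp add: power2_eq_square powr_add[symmetric] add_divide_distrib[symmetric]
          minus_divide_left del: minus_divide_left[symmetric])
    then show ?thesis
      using rate bigo_rates[OF lim rate] by simp
  qed
  show ?thesis
    using grad_tendsto_0 conv stationary_of_tendsto linear powr
    unfolding basic_PLK_def stationary_point_def by blast
qed

end
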